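(* Let $M$ be a q-tame persistence module. Then the radical $\operatorname{rad} M$ is isomorphic to a countable direct sum of interval modules.
   Context: Fix a field $\mathbf{k}$. A persistence module is a functor $M:(\mathbb{R},\le)\to \mathrm{Vect}_{\mathbf{k}}$. For an interval $J\subset\mathbb{R}$, the interval module $J$ is $\mathbf{k}$ at points of $J$ and $0$ elsewhere, with identity maps between points of $J$ and zero maps otherwise. $M$ is q-tame if for all $a<b$ the linear map $M(a<b):M(a)\to M(b)$ has finite rank. The radical of $M$ is the submodule $\operatorname{rad}M\subset M$ given by $(\operatorname{rad}M)(a)=\sum_{c<a}\operatorname{im}M(c<a)$, with structure maps restricted from $M$. Countable means finite or countably infinite. *)

theory Defs
  imports "HOL-Analysis.Topology_Euclidean_Space" "Jordan_Normal_Form.VS_Connect"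
begin

text \<open>The base field is the type \<open>'k :: field\<close>, viewed through \<^term>\<open>class_ring\<close> as a ring
  record; the spaces of a module are vector spaces over it in the carrier-based sense of
  \<^locale>\<open>vectorspace\<close>, each with its own carrier and operations.\<close>

record ('k, 'v) pers_mod =
  pm_space :: "real \<Rightarrow> ('k, 'v) module"
  pm_map :: "real \<Rightarrow> real \<Rightarrow> 'v \<Rightarrow> 'v"

text \<open>A functor on the poset of real numbers. The values of \<open>pm_map M a b\<close> for \<open>b < a\<close>, or outside the
  carrier of \<open>pm_space M a\<close>, are irrelevant. That each \<open>pm_space M a\<close> is a vector space is part of
  \<open>linear\<close> (take \<open>b = a\<close>).\<close>

locale persistence_module =
  fixes M :: "('k :: field, 'v) pers_mod"
  assumes linear: "a \<le> b \<Longrightarrow> linear_map class_ring (pm_space M a) (pm_space M b) (pm_map M a b)"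
    and map_id: "x \<in> carrier (pm_space M a) \<Longrightarrow> pm_map M a a x = x"
    and map_comp: "a \<le> b \<Longrightarrow> b \<le> c \<Longrightarrow> x \<in> carrier (pm_space M a) \<Longrightarrow>
      pm_map M b c (pm_map M a b x) = pm_map M a c x"

definition pm_im :: "('k, 'v) pers_mod \<Rightarrow> real \<Rightarrow> real \<Rightarrow> 'v set" where
  "pm_im M a b = pm_map M a b ` carrier (pm_space M a)"

definition q_tame :: "('k :: field, 'v) pers_mod \<Rightarrow> bool" where
  "q_tame M \<longleftrightarrow>
    (\<forall>a b. a < b \<longrightarrow> vectorspace.fin_dim class_ring ((pm_space M b)\<lparr>carrier := pm_im M a b\<rparr>))"

text \<open>The sum of the infinite family of subspaces \<open>pm_im M c a\<close>, \<open>c < a\<close>, consists of the finite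
  sums of elements of these subspaces.\<close>

definition rad :: "('k, 'v) pers_mod \<Rightarrow> ('k, 'v) pers_mod" where
  "rad M = \<lparr>
    pm_space = (\<lambda>a. (pm_space M a)\<lparr>carrier :=
      {finsum (pm_space M a) x C | x C. finite C \<and> C \<subseteq> {..<a} \<and> (\<forall>c\<in>C. x c \<in> pm_im M c a)}\<rparr>),
    pm_map = pm_map M\<rparr>"

text \<open>The fields \<open>mult\<close> and \<open>one\<close> of a module record carry no meaning in a vector space.\<close>

definition interval_module :: "real set \<Rightarrow> ('k :: field, 'k) pers_mod" where
  "interval_module J = \<lparr>
    pm_space = (\<lambda>a. \<lparr>carrier = (if a \<in> J then UNIV else {0}), mult = (*), one = 1,
      zero = 0, add = (+), smult = (*)\<rparr>),
    pm_map = (\<lambda>a b x. if a \<in> J \<and> b \<in> J then x else 0)\<rparr>"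

text \<open>Pointwise direct sum: finitely supported families, represented as extensional functions
  on \<open>I\<close>.\<close>

definition pm_direct_sum :: "'i set \<Rightarrow> ('i \<Rightarrow> ('k, 'v) pers_mod) \<Rightarrow> ('k, 'i \<Rightarrow> 'v) pers_mod" where
  "pm_direct_sum I N = \<lparr>
    pm_space = (\<lambda>a. \<lparr>
      carrier = {x \<in> \<Pi>\<^sub>E i\<in>I. carrier (pm_space (N i) a).
        finite {i \<in> I. x i \<noteq> \<zero>\<^bsub>pm_space (N i) a\<^esub>}},
      mult = (\<lambda>x y. \<lambda>i\<in>I. x i \<otimes>\<^bsub>pm_space (N i) a\<^esub> y i),
      one = (\<lambda>i\<in>I. \<one>\<^bsub>pm_space (N i) a\<^esub>),
      zero = (\<lambda>i\<in>I. \<zero>\<^bsub>pm_space (N i) a\<^esub>),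
      add = (\<lambda>x y. \<lambda>i\<in>I. x i \<oplus>\<^bsub>pm_space (N i) a\<^esub> y i),
      smult = (\<lambda>r x. \<lambda>i\<in>I. r \<odot>\<^bsub>pm_space (N i) a\<^esub> x i)\<rparr>),
    pm_map = (\<lambda>a b x. \<lambda>i\<in>I. pm_map (N i) a b (x i))\<rparr>"

definition pm_iso ::
    "('k :: field, 'v) pers_mod \<Rightarrow> ('k, 'w) pers_mod \<Rightarrow> (real \<Rightarrow> 'v \<Rightarrow> 'w) \<Rightarrow> bool" where
  "pm_iso M N h \<longleftrightarrow>
    (\<forall>a. linear_map class_ring (pm_space M a) (pm_space N a) (h a) \<and>
         bij_betw (h a) (carrier (pm_space M a)) (carrier (pm_space N a))) \<and>
    (\<forall>a b x. a \<le> b \<longrightarrow> x \<in> carrier (pm_space M a) \<longrightarrow>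
         h b (pm_map M a b x) = pm_map N a b (h a x))"

definition pm_isomorphic :: "('k :: field, 'v) pers_mod \<Rightarrow> ('k, 'w) pers_mod \<Rightarrow> bool" where
  "pm_isomorphic M N \<longleftrightarrow> (\<exists>h. pm_iso M N h)"

end

theory Submission
  imports Defs
begin

text \<open>
  The radical is the functor \<open>t \<mapsto> \<Union>s<t. im M(s < t)\<close>, an increasing union of finite-dimensional
  spaces. All its relevant properties are captured by calling a subfunctor \<open>S\<close> of \<open>M\<close> a
  \<open>radical_subfunctor\<close> if every \<open>x \<in> S t\<close> is the image of some element of an earlier \<open>S s\<close>. The
  proof splits interval modules off such subfunctors one at a time, and the countably many pairs of
  rationals serve as a work list which guarantees that nothing is left over.

  Splitting off one interval. Suppose that \<open>S(p) \<rightarrow> S(q)\<close> is not zero. Among the nonzero images of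
  \<open>S(s) \<rightarrow> S(q)\<close> with \<open>s \<le> p\<close> there is a smallest one, because \<open>M(p) \<rightarrow> M(q)\<close> has finite rank. A
  nonzero vector \<open>w\<close> in it is as old as possible: it comes from every \<open>s\<close> at which \<open>S(s) \<rightarrow> S(q)\<close> is
  nonzero. These \<open>s\<close> form an interval without a least element. Finite rank again provides a
  Mittag-Leffler argument, so \<open>w\<close> has compatible preimages \<open>y s\<close> at all those \<open>s\<close>
  (\<open>oldest_path_exists\<close>). Together with the images of \<open>w\<close> at times after \<open>q\<close> they span an interval
  submodule, supported on \<open>J = {t. y t \<noteq> 0}\<close>.

  It is a direct summand. By Zorn's lemma choose a maximal subfunctor \<open>S'\<close> of \<open>S\<close> that contains
  none of the nonzero \<open>y t\<close>. Maximality makes \<open>S'\<close> saturated: if \<open>x\<close> is moved into \<open>S'\<close> at a time in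
  \<open>J\<close>, then already \<open>x \<in> S'\<close>. With the exchange property of vector spaces this yields
  \<open>S t = k y t + S' t\<close> for \<open>t \<in> J\<close>; and \<open>S t = S' t\<close> for \<open>t\<close> before \<open>J\<close>, because everything that is
  older than \<open>w\<close> dies by the time \<open>q\<close> (\<open>complement_exists\<close>). The complement \<open>S'\<close> is
  again a radical subfunctor, and the rank of \<open>S'(p) \<rightarrow> S'(q)\<close> has dropped (\<open>interval_summand_exists\<close>).

  Exhaustion. Iterating from \<open>S 0 = rad M\<close>, with every pair of rationals treated infinitely often,
  gives a decreasing sequence \<open>S n\<close> such that \<open>S n(p) \<rightarrow> S n(q)\<close> eventually vanishes for each rational
  \<open>p < q\<close> (\<open>splitting_sequence_exists\<close>). An element of \<open>rad M\<close> at time \<open>t\<close> comes from some \<open>s < t\<close>, and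
  two rationals fit between \<open>s\<close> and \<open>t\<close>; hence its remainder in \<open>S n\<close> is zero for large \<open>n\<close>. So each
  element is a unique finite combination of the \<open>y n\<close>, and its coefficients give the isomorphism
  (\<open>decomposition\<close>).
\<close>

section \<open>Linear algebra over a field type\<close>

text \<open>The size of a maximal linearly independent subset strictly increases with the submodule, so a
  member for which it is least is minimal for inclusion. This descending chain condition is the only
  form in which finite rank enters the proof.\<close>

lemma (in vectorspace) minimal_submodule:
  assumes "fin_dim"
    and "\<W> \<noteq> {}"
    and sub: "\<And>W. W \<in> \<W> \<Longrightarrow> submodule K W V"
  shows "\<exists>W\<in>\<W>. \<forall>U\<in>\<W>. U \<subseteq> W \<longrightarrow> U = W"
proof -
  define indep where "indep W = {A. A \<subseteq> W \<and> lin_indpt A}" for W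
  define rk where "rk W = Max (card ` indep W)" for W
  have W_carrier: "W \<subseteq> carrier V" if "W \<in> \<W>" for W
    using sub[OF that] by (simp add: submodule_def)
  have fin: "finite (card ` indep W)" if "W \<in> \<W>" for W
  proof (rule finite_subset)
    show "card ` indep W \<subseteq> {..dim}"
      using li_le_dim(2)[OF assms(1)] W_carrier[OF that] by (auto simp: indep_def)
  qed simp
  \<comment> \<open>A maximal independent subset of \<open>U\<close> stays independent after adding a vector of \<open>W - U\<close>.\<close>
  have rk_less: "rk U < rk W" if "U \<in> \<W>" "W \<in> \<W>" "U \<subset> W" for U W
  proof -
    have "{} \<in> indep U" by (auto simp: indep_def lin_dep_def)
    then have "rk U \<in> card ` indep U"
      unfolding rk_def using fin[OF that(1)] by (intro Max_in) auto
    then obtain A where A: "A \<subseteq> U" "lin_indpt A" "rk U = card A"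
      by (auto simp: indep_def)
    obtain x where x: "x \<in> W" "x \<notin> U" using \<open>U \<subset> W\<close> by blast
    have Ac: "A \<subseteq> carrier V" and xc: "x \<in> carrier V"
      using A(1) x W_carrier[OF that(1)] W_carrier[OF that(2)] by blast+
    have "span A \<subseteq> U" using A(1) sub[OF that(1)] by (rule span_is_subset)
    then have "x \<notin> span A" using x by blast
    moreover have "x \<notin> A" using A x by blast
    ultimately have "lin_indpt (insert x A)"
      using lin_dep_iff_in_span[OF Ac A(2) xc] by simp
    then have "insert x A \<in> indep W" using A x that by (auto simp: indep_def)
    then have "card (insert x A) \<le> rk W"
      unfolding rk_def using fin[OF that(2)] by (intro Max_ge) auto
    moreover have "finite A" using li_le_dim(1)[OF assms(1) Ac A(2)] .
    ultimately show ?thesis using A(3) \<open>x \<notin> A\<close> by simp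
  qed
  obtain W where "W \<in> \<W>" "\<And>U. U \<in> \<W> \<Longrightarrow> rk W \<le> rk U"
    using assms(2) ex_has_least_nat[of "\<lambda>W. W \<in> \<W>" _ rk] by blast
  then have "U = W" if "U \<in> \<W>" "U \<subseteq> W" for U
    using rk_less[of U W] that by (auto simp: psubset_eq not_less[symmetric])
  with \<open>W \<in> \<W>\<close> show ?thesis by blast
qed

definition adjoin :: "('k :: field, 'v) module \<Rightarrow> 'v set \<Rightarrow> 'v \<Rightarrow> 'v set" where
  "adjoin V P x = {c \<odot>\<^bsub>V\<^esub> x \<oplus>\<^bsub>V\<^esub> p | c p. p \<in> P}"

context
  fixes V :: "('k :: field, 'v) module" (structure)
  assumes V: "vectorspace class_ring V"
begin

interpretation vectorspace class_ring V by (rule V)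

lemma scalar_closed: "x \<in> carrier V \<Longrightarrow> c \<odot> x \<in> carrier V"
  and scalar_add: "x \<in> carrier V \<Longrightarrow> (a + b) \<odot> x = a \<odot> x \<oplus> b \<odot> x"
  and scalar_mult: "x \<in> carrier V \<Longrightarrow> (a * b) \<odot> x = a \<odot> (b \<odot> x)"
  and scalar_distrib: "x \<in> carrier V \<Longrightarrow> y \<in> carrier V \<Longrightarrow> a \<odot> (x \<oplus> y) = a \<odot> x \<oplus> a \<odot> y"
  and scalar_one: "x \<in> carrier V \<Longrightarrow> 1 \<odot> x = x"
  and scalar_zero: "x \<in> carrier V \<Longrightarrow> 0 \<odot> x = \<zero>"
  using smult_closed[of c x] smult_l_distr[of a b x] smult_assoc1[of a b x]
    smult_r_distr[of a x y] smult_one[of x] smult_l_null[of x]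
  by simp_all

context
  fixes P :: "'v set"
  assumes P: "submodule class_ring P V"
begin

lemma submodule_carrier: "p \<in> P \<Longrightarrow> p \<in> carrier V"
  using P by (auto simp: submodule_def)

lemma submodule_zero: "\<zero> \<in> P" and submodule_add: "p \<in> P \<Longrightarrow> p' \<in> P \<Longrightarrow> p \<oplus> p' \<in> P"
  and submodule_scalar: "p \<in> P \<Longrightarrow> c \<odot> p \<in> P"
  using P by (auto simp: submodule_def)

lemma mem_adjoin: "p \<in> P \<Longrightarrow> c \<odot> x \<oplus> p \<in> adjoin V P x"
  by (auto simp: adjoin_def)

lemma subset_adjoin:
  assumes "x \<in> carrier V"
  shows "P \<subseteq> adjoin V P x"
proof
  fix p assume "p \<in> P"
  then have "p = 0 \<odot> x \<oplus> p"
    using assms submodule_carrier scalar_zero[of x] by simp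
  with \<open>p \<in> P\<close> show "p \<in> adjoin V P x" using mem_adjoin by metis
qed

lemma self_mem_adjoin:
  assumes "x \<in> carrier V"
  shows "x \<in> adjoin V P x"
  using mem_adjoin[OF submodule_zero, of 1 x] assms scalar_one[of x] by simp

lemma submodule_adjoin:
  assumes x: "x \<in> carrier V"
  shows "submodule class_ring (adjoin V P x) V"
proof
  show "adjoin V P x \<subseteq> carrier V"
    using x by (auto simp: adjoin_def submodule_carrier scalar_closed)
  show "\<zero> \<in> adjoin V P x"
    using subset_adjoin[OF x] submodule_zero by blast
next
  fix v w assume "v \<in> adjoin V P x" "w \<in> adjoin V P x"
  then obtain c p d q where v: "v = c \<odot> x \<oplus> p" "p \<in> P" and w: "w = d \<odot> x \<oplus> q" "q \<in> P"
    by (auto simp: adjoin_def)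
  have "v \<oplus> w = (c + d) \<odot> x \<oplus> (p \<oplus> q)"
    using x v w by (simp add: scalar_add scalar_closed submodule_carrier a_ac)
  then show "v \<oplus> w \<in> adjoin V P x" using v w mem_adjoin submodule_add by metis
next
  fix a v assume "v \<in> adjoin V P x"
  then obtain c p where v: "v = c \<odot> x \<oplus> p" "p \<in> P"
    by (auto simp: adjoin_def)
  have "a \<odot> v = (a * c) \<odot> x \<oplus> a \<odot> p"
    using x v by (simp add: scalar_distrib scalar_mult scalar_closed submodule_carrier)
  then show "a \<odot> v \<in> adjoin V P x" using v mem_adjoin submodule_scalar by metis
qed

lemma exchange_adjoin:
  assumes x: "x \<in> carrier V" and y: "y \<in> adjoin V P x" "y \<notin> P"
  shows "x \<in> adjoin V P y"
proof -
  obtain c p where y_eq: "y = c \<odot> x \<oplus> p" and p: "p \<in> P" using y(1) by (auto simp: adjoin_def)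
  have "c \<noteq> 0" using y(2) y_eq p x by (auto simp: scalar_zero submodule_carrier)
  have "(1/c) \<odot> y \<oplus> (-1/c) \<odot> p = (1/c * c) \<odot> x \<oplus> ((1/c) \<odot> p \<oplus> (-1/c) \<odot> p)"
    unfolding y_eq scalar_mult[OF x] using x p by (simp add: scalar_distrib scalar_closed submodule_carrier a_assoc)
  also have "(1/c) \<odot> p \<oplus> (-1/c) \<odot> p = \<zero>"
    using scalar_add[of p "1/c" "-1/c"] scalar_zero[of p] p submodule_carrier by simp
  also have "(1/c * c) \<odot> x \<oplus> \<zero> = x" using \<open>c \<noteq> 0\<close> x by (simp add: scalar_one)
  finally show ?thesis using mem_adjoin[OF submodule_scalar[OF p, of "-1/c"], of "1/c" y] by simp
qed

lemma adjoin_decomposition_unique: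
  assumes x: "x \<in> carrier V" and p: "p \<in> P" "p' \<in> P"
    and eq: "c \<odot> x \<oplus> p = c' \<odot> x \<oplus> p'"
    and "x \<in> P \<Longrightarrow> c = c'"
  shows "c = c' \<and> p = p'"
proof -
  define d where "d = c - c'"
  have "(d \<odot> x \<oplus> p) \<oplus> c' \<odot> x = c \<odot> x \<oplus> p"
    using scalar_add[OF x, of d c'] x p(1) by (simp add: d_def scalar_closed submodule_carrier a_ac)
  also have "\<dots> = p' \<oplus> c' \<odot> x" unfolding eq using x p by (simp add: scalar_closed submodule_carrier a_comm)
  finally have p': "d \<odot> x \<oplus> p = p'" using x p by (simp add: scalar_closed submodule_carrier)
  have "d = 0"
  proof (rule ccontr)
    assume "d \<noteq> 0"
    have "d \<odot> x = p' \<oplus> (-1) \<odot> p"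
      unfolding p'[symmetric] using scalar_add[of p 1 "-1"] scalar_zero[of p] scalar_one[of p] x p(1)
      by (simp add: a_assoc scalar_closed submodule_carrier)
    then have "d \<odot> x \<in> P" using p submodule_add submodule_scalar by simp
    then have "(1/d) \<odot> (d \<odot> x) \<in> P" by (rule submodule_scalar)
    then have "x \<in> P" using scalar_mult[OF x, of "1/d" d] \<open>d \<noteq> 0\<close> scalar_one[OF x] by simp
    then show False using assms(5) \<open>d \<noteq> 0\<close> by (simp add: d_def)
  qed
  then show ?thesis using p' x p by (simp add: d_def scalar_zero submodule_carrier)
qed

end

end

section \<open>Interval summands of subfunctors\<close>

context persistence_module
begin

abbreviation V where "V \<equiv> pm_space M"
abbreviation T where "T \<equiv> pm_map M"

lemma vectorspace_V: "vectorspace class_ring (V t)"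
  using linear[of t t] by (simp add: linear_map_def)

sublocale V: vectorspace class_ring "V t" for t
  by (rule vectorspace_V)

lemmas scalar =
  scalar_add[OF vectorspace_V]
  scalar_mult[OF vectorspace_V]
  scalar_distrib[OF vectorspace_V]
  scalar_zero[OF vectorspace_V]
  scalar_closed[OF vectorspace_V]

lemma T_closed: "s \<le> t \<Longrightarrow> x \<in> carrier (V s) \<Longrightarrow> T s t x \<in> carrier (V t)"
  and T_add: "s \<le> t \<Longrightarrow> x \<in> carrier (V s) \<Longrightarrow> y \<in> carrier (V s) \<Longrightarrow>
    T s t (x \<oplus>\<^bsub>V s\<^esub> y) = T s t x \<oplus>\<^bsub>V t\<^esub> T s t y"
  and T_smult: "s \<le> t \<Longrightarrow> x \<in> carrier (V s) \<Longrightarrow>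
    T s t (c \<odot>\<^bsub>V s\<^esub> x) = c \<odot>\<^bsub>V t\<^esub> T s t x"
  and T_zero: "s \<le> t \<Longrightarrow> T s t \<zero>\<^bsub>V s\<^esub> = \<zero>\<^bsub>V t\<^esub>"
proof -
  assume "s \<le> t"
  then interpret f: linear_map class_ring "V s" "V t" "T s t" by (rule linear)
  show "x \<in> carrier (V s) \<Longrightarrow> T s t x \<in> carrier (V t)"
    "x \<in> carrier (V s) \<Longrightarrow> y \<in> carrier (V s) \<Longrightarrow>
      T s t (x \<oplus>\<^bsub>V s\<^esub> y) = T s t x \<oplus>\<^bsub>V t\<^esub> T s t y"
    "x \<in> carrier (V s) \<Longrightarrow> T s t (c \<odot>\<^bsub>V s\<^esub> x) = c \<odot>\<^bsub>V t\<^esub> T s t x"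
    "T s t \<zero>\<^bsub>V s\<^esub> = \<zero>\<^bsub>V t\<^esub>"
    using f.T_smult[of c x] by simp_all
qed

definition subfunctor :: "(real \<Rightarrow> 'v set) \<Rightarrow> bool" where
  "subfunctor S \<longleftrightarrow> (\<forall>t. submodule class_ring (S t) (V t)) \<and>
    (\<forall>s t. s \<le> t \<longrightarrow> T s t ` S s \<subseteq> S t)"

text \<open>The reverse inclusion holds for every subfunctor, so \<open>S\<close> equals its own radical. This property is
  inherited by direct summands, which makes it possible to split off intervals repeatedly.\<close>

definition radical_subfunctor :: "(real \<Rightarrow> 'v set) \<Rightarrow> bool" where
  "radical_subfunctor S \<longleftrightarrow> subfunctor S \<and> (\<forall>t. S t \<subseteq> (\<Union>s\<in>{..<t}. T s t ` S s))"

lemma subfunctor_sub: "subfunctor S \<Longrightarrow> submodule class_ring (S t) (V t)"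
  and subfunctor_carrier: "subfunctor S \<Longrightarrow> x \<in> S t \<Longrightarrow> x \<in> carrier (V t)"
  and subfunctor_T: "subfunctor S \<Longrightarrow> s \<le> t \<Longrightarrow> x \<in> S s \<Longrightarrow> T s t x \<in> S t"
  and subfunctor_zero: "subfunctor S \<Longrightarrow> \<zero>\<^bsub>V t\<^esub> \<in> S t"
  and subfunctor_add: "subfunctor S \<Longrightarrow> x \<in> S t \<Longrightarrow> y \<in> S t \<Longrightarrow> x \<oplus>\<^bsub>V t\<^esub> y \<in> S t"
  and subfunctor_smult: "subfunctor S \<Longrightarrow> x \<in> S t \<Longrightarrow> c \<odot>\<^bsub>V t\<^esub> x \<in> S t"
  by (auto simp: subfunctor_def submodule_def image_subset_iff)

lemma radical_subfunctorD:
  assumes "radical_subfunctor S"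
  shows "subfunctor S"
    and "x \<in> S t \<Longrightarrow> \<exists>s<t. \<exists>z\<in>S s. x = T s t z"
  using assms unfolding radical_subfunctor_def by (blast, fast)

text \<open>A direct sum decomposition of \<open>S\<close> into \<open>S'\<close> and the interval module spanned by the vectors \<open>y t\<close>.
  The interval is the support \<open>{t. y t \<noteq> 0}\<close>, which may be empty. A vector \<open>y t\<close> may die, but
  \<open>y s = 0\<close> for an early \<open>s\<close> says nothing about later times.\<close>

definition splits_off :: "(real \<Rightarrow> 'v set) \<Rightarrow> (real \<Rightarrow> 'v) \<Rightarrow> (real \<Rightarrow> 'v set) \<Rightarrow> bool" where
  "splits_off S y S' \<longleftrightarrow>
    (\<forall>t. y t \<in> S t \<and> S' t \<subseteq> S t \<and> S t \<subseteq> adjoin (V t) (S' t) (y t)) \<and>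
    (\<forall>t. y t \<noteq> \<zero>\<^bsub>V t\<^esub> \<longrightarrow> y t \<notin> S' t) \<and>
    (\<forall>s t. s \<le> t \<longrightarrow> y s \<noteq> \<zero>\<^bsub>V s\<^esub> \<longrightarrow> T s t (y s) = y t)"

text \<open>The hypothesis \<open>oldest\<close> makes everything that lives before the support of \<open>y\<close> vanish at \<open>q\<close>,
  so that no vector of the interval has a preimage at an earlier time; an interval submodule whose
  vectors do have such preimages cannot be a summand. The complement is a maximal subfunctor
  that avoids the interval.\<close>

lemma complement_exists:
  assumes S: "subfunctor S"
    and y: "\<And>t. y t \<in> S t"
    and path: "\<And>s t. s \<le> t \<Longrightarrow> y s \<noteq> \<zero>\<^bsub>V s\<^esub> \<Longrightarrow> T s t (y s) = y t"
    and q: "y q \<noteq> \<zero>\<^bsub>V q\<^esub>"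
    and oldest: "\<And>s x. s \<le> q \<Longrightarrow> y s = \<zero>\<^bsub>V s\<^esub> \<Longrightarrow> x \<in> S s \<Longrightarrow> T s q x = \<zero>\<^bsub>V q\<^esub>"
  obtains S' where "subfunctor S'" "splits_off S y S'"
proof -
  \<comment> \<open>Families of subspaces are encoded as sets of pairs, which turns pointwise inclusion into the
    set inclusion of Zorn's lemma.\<close>
  define \<A> where "\<A> = {Q. subfunctor (\<lambda>t. Q `` {t}) \<and> (\<forall>t. Q `` {t} \<subseteq> S t) \<and>
    (\<forall>t. y t \<noteq> \<zero>\<^bsub>V t\<^esub> \<longrightarrow> (t, y t) \<notin> Q)}"
  have y_carrier: "y t \<in> carrier (V t)" for t
    using subfunctor_carrier[OF S y] .
  have "\<exists>Q\<in>\<A>. \<forall>X\<in>\<A>. Q \<subseteq> X \<longrightarrow> X = Q"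
  proof (rule subset_Zorn_nonempty)
    have "{(t, \<zero>\<^bsub>V t\<^esub>) | t. True} \<in> \<A>"
    proof -
      have *: "{(t, \<zero>\<^bsub>V t\<^esub>) | t. True} `` {t} = {\<zero>\<^bsub>V t\<^esub>}" for t by auto
      have "submodule class_ring {\<zero>\<^bsub>V t\<^esub>} (V t)" for t
        by unfold_locales auto
      then show ?thesis
        unfolding \<A>_def mem_Collect_eq subfunctor_def *
        using subfunctor_zero[OF S] by (auto simp: T_zero)
    qed
    then show "\<A> \<noteq> {}" by blast
  next
    fix \<C> assume \<C>: "\<C> \<noteq> {}" "subset.chain \<A> \<C>"
    then have \<C>\<A>: "\<C> \<subseteq> \<A>" by (simp add: subset.chain_def)
    have sf: "subfunctor (\<lambda>t. Q `` {t})" if "Q \<in> \<C>" for Q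
      using that \<C>\<A> by (auto simp: \<A>_def)
    have "subfunctor (\<lambda>t. \<Union>\<C> `` {t})"
      unfolding subfunctor_def
    proof (intro conjI allI impI)
      fix t
      show "submodule class_ring (\<Union>\<C> `` {t}) (V t)"
      proof
        show "\<Union>\<C> `` {t} \<subseteq> carrier (V t)"
          using subfunctor_carrier[OF sf] by auto
        show "\<zero>\<^bsub>V t\<^esub> \<in> \<Union>\<C> `` {t}"
          using subfunctor_zero[OF sf] \<C>(1) by blast
        fix v assume v: "v \<in> \<Union>\<C> `` {t}"
        then obtain Q where Q: "Q \<in> \<C>" "(t, v) \<in> Q" by auto
        show "c \<odot>\<^bsub>V t\<^esub> v \<in> \<Union>\<C> `` {t}" for c
          using subfunctor_smult[OF sf[OF Q(1)], of v t c] Q by auto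
        fix w assume "w \<in> \<Union>\<C> `` {t}"
        then obtain Q' where Q': "Q' \<in> \<C>" "(t, w) \<in> Q'" by auto
        obtain Q'' where "Q'' \<in> \<C>" "(t, v) \<in> Q''" "(t, w) \<in> Q''"
          using \<C>(2) Q Q' unfolding subset.chain_def by blast
        then show "v \<oplus>\<^bsub>V t\<^esub> w \<in> \<Union>\<C> `` {t}"
          using subfunctor_add[OF sf[of Q''], of v t w] by auto
      qed
    next
      fix s t :: real assume "s \<le> t"
      then show "T s t ` (\<Union>\<C> `` {s}) \<subseteq> \<Union>\<C> `` {t}"
        using subfunctor_T[OF sf, of _ s t] by fastforce
    qed
    then show "\<Union>\<C> \<in> \<A>" using \<C>\<A> by (auto simp: \<A>_def)
  qed
  then obtain Q where "Q \<in> \<A>" and max: "\<And>X. X \<in> \<A> \<Longrightarrow> Q \<subseteq> X \<Longrightarrow> X = Q" by blast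
  define P where "P t = Q `` {t}" for t
  have P: "subfunctor P" "P t \<subseteq> S t" "y t \<noteq> \<zero>\<^bsub>V t\<^esub> \<Longrightarrow> y t \<notin> P t" for t
    using \<open>Q \<in> \<A>\<close> by (auto simp: \<A>_def P_def[abs_def])
  note adj = subset_adjoin[OF vectorspace_V subfunctor_sub[OF P(1)]]
    self_mem_adjoin[OF vectorspace_V subfunctor_sub[OF P(1)]]
    submodule_adjoin[OF vectorspace_V subfunctor_sub[OF P(1)]]
  \<comment> \<open>Maximality: the subfunctor generated by \<open>P\<close> and one further vector meets the interval.\<close>
  have blocked: "\<exists>u\<ge>t. y u \<noteq> \<zero>\<^bsub>V u\<^esub> \<and> y u \<in> adjoin (V u) (P u) (T t u x)"
    if x: "x \<in> S t" "x \<notin> P t" for t x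
  proof (rule ccontr)
    assume no: "\<not> ?thesis"
    define P' where "P' u = (if t \<le> u then adjoin (V u) (P u) (T t u x) else P u)" for u
    define X where "X = Sigma UNIV P'"
    have X: "X `` {u} = P' u" for u by (auto simp: X_def)
    have Tx: "t \<le> u \<Longrightarrow> T t u x \<in> S u" "t \<le> u \<Longrightarrow> T t u x \<in> carrier (V u)" for u
      using subfunctor_T[OF S, of t u x] subfunctor_carrier[OF S, of "T t u x" u] x by auto
    have PP': "P u \<subseteq> P' u" for u
      using adj(1)[of "T t u x" u] Tx by (auto simp: P'_def)
    have "X \<in> \<A>"
      unfolding \<A>_def mem_Collect_eq X subfunctor_def
    proof (intro conjI allI impI)
      fix u
      show "submodule class_ring (P' u) (V u)"
        using adj(3) Tx subfunctor_sub[OF P(1)] by (simp add: P'_def)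
      show "P' u \<subseteq> S u"
        using P(2)[of u] Tx(1)[of u] by (auto simp: P'_def adjoin_def intro!: subfunctor_add[OF S] subfunctor_smult[OF S])
      show "(u, y u) \<notin> X" if "y u \<noteq> \<zero>\<^bsub>V u\<^esub>"
        using no that P(3)[of u] by (auto simp: X_def P'_def)
    next
      fix r s :: real assume "r \<le> s"
      show "T r s ` P' r \<subseteq> P' s"
      proof (cases "t \<le> r")
        case False
        then show ?thesis
          using subfunctor_T[OF P(1) \<open>r \<le> s\<close>] PP'[of s] by (auto simp: P'_def[of r])
      next
        case True
        have "T r s (c \<odot>\<^bsub>V r\<^esub> T t r x \<oplus>\<^bsub>V r\<^esub> p) \<in> P' s" if "p \<in> P r" for c p
        proof -
          have "T r s (c \<odot>\<^bsub>V r\<^esub> T t r x \<oplus>\<^bsub>V r\<^esub> p) = c \<odot>\<^bsub>V s\<^esub> T t s x \<oplus>\<^bsub>V s\<^esub> T r s p"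
            using True \<open>r \<le> s\<close> Tx that subfunctor_carrier[OF P(1) that] subfunctor_carrier[OF S x(1)]
            by (simp add: T_add T_smult map_comp)
          then show ?thesis
            using True \<open>r \<le> s\<close> subfunctor_T[OF P(1) \<open>r \<le> s\<close> that] by (auto simp: P'_def adjoin_def)
        qed
        then show ?thesis using True by (auto simp: P'_def[of r] adjoin_def)
      qed
    qed
    moreover have "Q \<subseteq> X" using PP' by (auto simp: X_def P_def)
    ultimately have "X = Q" by (rule max)
    then have "P' t = P t" using X[of t] by (simp add: P_def)
    moreover have "x \<in> P' t"
      using adj(2)[of x t] subfunctor_carrier[OF S x(1)] by (simp add: P'_def map_id)
    ultimately show False using x by simp
  qed
  \<comment> \<open>If \<open>x\<close> were not in \<open>P t\<close>, then \<open>y v\<close> would be a multiple of the image of \<open>x\<close> modulo \<open>P v\<close>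
    for some \<open>v\<close>; moving to the later one of \<open>u\<close> and \<open>v\<close> puts a nonzero \<open>y\<close> into \<open>P\<close>.\<close>
  have saturated: "x \<in> P t"
    if x: "x \<in> S t" "T t u x \<in> P u" and "t \<le> u" "y u \<noteq> \<zero>\<^bsub>V u\<^esub>" for t u x
  proof (rule ccontr)
    assume "x \<notin> P t"
    then obtain v c p where v: "t \<le> v" "y v \<noteq> \<zero>\<^bsub>V v\<^esub>" and p: "p \<in> P v"
      and yv: "y v = c \<odot>\<^bsub>V v\<^esub> T t v x \<oplus>\<^bsub>V v\<^esub> p"
      using blocked[OF x(1)] by (auto simp: adjoin_def)
    have xc: "x \<in> carrier (V t)" using subfunctor_carrier[OF S x(1)] .
    show False
    proof (cases "u \<le> v")
      case True
      have "T t v x \<in> P v"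
        using subfunctor_T[OF P(1) True x(2)] True \<open>t \<le> u\<close> xc by (simp add: map_comp)
      then have "y v \<in> P v" unfolding yv using p subfunctor_add[OF P(1)] subfunctor_smult[OF P(1)] by simp
      then show False using P(3) v by blast
    next
      case False
      have "y u = T v u (y v)" using path[of v u] False v by simp
      also have "\<dots> = c \<odot>\<^bsub>V u\<^esub> T t u x \<oplus>\<^bsub>V u\<^esub> T v u p"
        unfolding yv using False v T_closed[OF v(1) xc] subfunctor_carrier[OF P(1) p] xc
        by (simp add: T_add T_smult map_comp)
      also have "\<dots> \<in> P u"
        using x(2) subfunctor_T[OF P(1), of v u p] p False
        by (intro subfunctor_add[OF P(1)] subfunctor_smult[OF P(1)]) auto
      finally show False using P(3) \<open>y u \<noteq> _\<close> by blast
    qed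
  qed
  have "x \<in> adjoin (V t) (P t) (y t)" if x: "x \<in> S t" for t x
  proof (cases "x \<in> P t")
    case True
    then show ?thesis using adj(1)[OF y_carrier] by blast
  next
    case False
    then obtain u where u: "t \<le> u" "y u \<noteq> \<zero>\<^bsub>V u\<^esub>" "y u \<in> adjoin (V u) (P u) (T t u x)"
      using blocked[OF x] by blast
    have xc: "x \<in> carrier (V t)" using subfunctor_carrier[OF S x] .
    show ?thesis
    proof (cases "y t = \<zero>\<^bsub>V t\<^esub>")
      case True
      \<comment> \<open>Once the path has died it cannot be alive at the later time \<open>u\<close>, so \<open>t\<close> lies before the
        interval, where \<open>oldest\<close> and saturation apply.\<close>
      have "t \<le> q"
      proof (rule ccontr)
        assume "\<not> t \<le> q"
        then have "y u = T t u (y t)"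
          using path[of q u] path[of q t] q u(1) map_comp[of q t u "y q"] y_carrier[of q] by auto
        then show False using True u T_zero[OF u(1)] by simp
      qed
      then have "T t q x \<in> P q" using oldest[OF _ True x] subfunctor_zero[OF P(1)] by simp
      then have "x \<in> P t" using saturated[OF x _ \<open>t \<le> q\<close> q] by simp
      then show ?thesis using False by simp
    next
      case yt: False
      have "T t u x \<in> adjoin (V u) (P u) (y u)"
        using exchange_adjoin[OF vectorspace_V subfunctor_sub[OF P(1)] _ u(3)] P(3)[OF u(2)]
          T_closed[OF u(1) xc] by simp
      then obtain c p where p: "p \<in> P u" and xu: "T t u x = c \<odot>\<^bsub>V u\<^esub> y u \<oplus>\<^bsub>V u\<^esub> p"
        by (auto simp: adjoin_def)
      have pc: "p \<in> carrier (V u)" using subfunctor_carrier[OF P(1) p] .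
      \<comment> \<open>The multiple of \<open>y u\<close> that has to be subtracted at time \<open>u\<close> can be subtracted at time \<open>t\<close>
        already; saturation shows that the difference lies in \<open>P t\<close>.\<close>
      define z where "z = (- c) \<odot>\<^bsub>V t\<^esub> y t \<oplus>\<^bsub>V t\<^esub> x"
      have "T t u z = (- c) \<odot>\<^bsub>V u\<^esub> T t u (y t) \<oplus>\<^bsub>V u\<^esub> T t u x"
        unfolding z_def using u(1) xc y_carrier by (simp add: T_add T_smult scalar)
      also have "\<dots> = (- c) \<odot>\<^bsub>V u\<^esub> y u \<oplus>\<^bsub>V u\<^esub> (c \<odot>\<^bsub>V u\<^esub> y u \<oplus>\<^bsub>V u\<^esub> p)"
        unfolding xu path[OF u(1) yt] by (rule refl)
      also have "\<dots> = ((- c) \<odot>\<^bsub>V u\<^esub> y u \<oplus>\<^bsub>V u\<^esub> c \<odot>\<^bsub>V u\<^esub> y u) \<oplus>\<^bsub>V u\<^esub> p"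
        using y_carrier pc by (simp add: V.a_assoc scalar)
      also have "\<dots> = p" using scalar(1)[of "y u" u "-c" c] scalar(4)[of "y u" u] y_carrier pc by simp
      finally have "T t u z \<in> P u" using p by simp
      moreover have "z \<in> S t"
        unfolding z_def by (intro subfunctor_add[OF S] subfunctor_smult[OF S] x y)
      ultimately have "z \<in> P t" using saturated u by blast
      moreover have "x = c \<odot>\<^bsub>V t\<^esub> y t \<oplus>\<^bsub>V t\<^esub> z"
      proof -
        have "c \<odot>\<^bsub>V t\<^esub> y t \<oplus>\<^bsub>V t\<^esub> z = (c \<odot>\<^bsub>V t\<^esub> y t \<oplus>\<^bsub>V t\<^esub> (- c) \<odot>\<^bsub>V t\<^esub> y t) \<oplus>\<^bsub>V t\<^esub> x"
          unfolding z_def using y_carrier xc by (simp add: V.a_assoc scalar)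
        then show ?thesis
          using scalar(1)[of "y t" t c "-c"] scalar(4)[of "y t" t] y_carrier xc by simp
      qed
      ultimately show ?thesis by (auto simp: adjoin_def)
    qed
  qed
  then have "splits_off S y P" using P y path by (auto simp: splits_off_def)
  with P(1) show thesis by (rule that)
qed

text \<open>Split a preimage of \<open>x \<in> S' t\<close> into its components: uniqueness of the decomposition at
  time \<open>t\<close> forces the component along \<open>y\<close> to disappear, and so the other one is a preimage too.\<close>

lemma splits_off_radical:
  assumes S: "radical_subfunctor S" and S': "subfunctor S'" and split: "splits_off S y S'"
  shows "radical_subfunctor S'"
  unfolding radical_subfunctor_def
proof (intro conjI allI subsetI S')
  fix t x assume x: "x \<in> S' t"
  note sp = split[unfolded splits_off_def]
  have "x \<in> S t" using x sp by blast
  then obtain s z where s: "s < t" and z: "z \<in> S s" and xz: "x = T s t z"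
    using radical_subfunctorD(2)[OF S] by blast
  have yc: "y t \<in> carrier (V t)" for t
    using sp subfunctor_carrier[OF radical_subfunctorD(1)[OF S]] by blast
  have "z \<in> adjoin (V s) (S' s) (y s)" using z sp by blast
  then obtain c p where p: "p \<in> S' s" and zc: "z = c \<odot>\<^bsub>V s\<^esub> y s \<oplus>\<^bsub>V s\<^esub> p"
    by (auto simp: adjoin_def)
  have pc: "p \<in> carrier (V s)" using subfunctor_carrier[OF S' p] .
  have Tp: "T s t p \<in> S' t" "T s t p \<in> carrier (V t)"
    using subfunctor_T[OF S' _ p] subfunctor_carrier[OF S'] s by auto
  have "x = T s t p"
  proof (cases "y s = \<zero>\<^bsub>V s\<^esub>")
    case True
    then show ?thesis using xz zc V.smult_r_null[of c s] pc by simp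
  next
    case False
    then have Ty: "T s t (y s) = y t" using sp s by simp
    have "0 \<odot>\<^bsub>V t\<^esub> y t \<oplus>\<^bsub>V t\<^esub> x = c \<odot>\<^bsub>V t\<^esub> y t \<oplus>\<^bsub>V t\<^esub> T s t p"
      unfolding xz zc using s yc pc Ty Tp by (simp add: T_add T_smult scalar)
    then have eq: "c \<odot>\<^bsub>V t\<^esub> y t \<oplus>\<^bsub>V t\<^esub> T s t p = 0 \<odot>\<^bsub>V t\<^esub> y t \<oplus>\<^bsub>V t\<^esub> x" by simp
    show ?thesis
    proof (cases "y t = \<zero>\<^bsub>V t\<^esub>")
      case True
      then show ?thesis
        using eq V.smult_r_null[of c t] V.smult_r_null[of 0 t] Tp subfunctor_carrier[OF S' x] by simp
    next
      case False
      then have "y t \<notin> S' t" using sp by simp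
      then show ?thesis
        using adjoin_decomposition_unique[OF vectorspace_V subfunctor_sub[OF S'] yc Tp(1) x eq] by simp
    qed
  qed
  then show "x \<in> (\<Union>s\<in>{..<t}. T s t ` S' s)" using s p by blast
qed

lemma submodule_image:
  assumes S: "subfunctor S" and "s \<le> t"
  shows "submodule class_ring (T s t ` S s) (V t)"
proof
  note Sc = subfunctor_carrier[OF S]
  show "T s t ` S s \<subseteq> carrier (V t)" using T_closed[OF \<open>s \<le> t\<close>] Sc by blast
  show "\<zero>\<^bsub>V t\<^esub> \<in> T s t ` S s"
    using T_zero[OF \<open>s \<le> t\<close>] subfunctor_zero[OF S] by (metis imageI)
  fix v assume "v \<in> T s t ` S s"
  then obtain x where x: "x \<in> S s" "v = T s t x" by blast
  show "c \<odot>\<^bsub>V t\<^esub> v \<in> T s t ` S s" for c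
    using T_smult[OF \<open>s \<le> t\<close> Sc[OF x(1)]] subfunctor_smult[OF S x(1)] x(2) by (metis imageI)
  fix w assume "w \<in> T s t ` S s"
  then obtain z where z: "z \<in> S s" "w = T s t z" by blast
  show "v \<oplus>\<^bsub>V t\<^esub> w \<in> T s t ` S s"
    using T_add[OF \<open>s \<le> t\<close> Sc[OF x(1)] Sc[OF z(1)]] subfunctor_add[OF S x(1) z(1)] x(2) z(2)
    by (metis imageI)
qed

lemma image_antimono:
  assumes S: "subfunctor S" and "r \<le> s" "s \<le> t"
  shows "T r t ` S r \<subseteq> T s t ` S s"
proof
  fix v assume "v \<in> T r t ` S r"
  then obtain x where x: "x \<in> S r" "v = T r t x" by blast
  have "v = T s t (T r s x)" "T r s x \<in> S s"
    using x assms(2,3) subfunctor_carrier[OF S x(1)] subfunctor_T[OF S \<open>r \<le> s\<close>]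
    by (auto simp: map_comp)
  then show "v \<in> T s t ` S s" by blast
qed

lemma subfunctor_carrier_V: "subfunctor (\<lambda>t. carrier (V t))"
  unfolding subfunctor_def
proof (intro conjI allI impI)
  show "submodule class_ring (carrier (V t)) (V t)" for t by unfold_locales auto
  show "s \<le> t \<Longrightarrow> T s t ` carrier (V s) \<subseteq> carrier (V t)" for s t using T_closed by blast
qed

lemma submodule_pm_im: "s \<le> t \<Longrightarrow> submodule class_ring (pm_im M s t) (V t)"
  unfolding pm_im_def by (rule submodule_image[OF subfunctor_carrier_V])

lemma pm_im_mono: "r \<le> s \<Longrightarrow> s \<le> t \<Longrightarrow> pm_im M r t \<subseteq> pm_im M s t"
  unfolding pm_im_def by (rule image_antimono[OF subfunctor_carrier_V])

lemma image_subset_pm_im: "subfunctor S \<Longrightarrow> T s t ` S s \<subseteq> pm_im M s t"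
  using subfunctor_carrier by (auto simp: pm_im_def)

end

locale q_tame_module = persistence_module M for M :: "('k :: field, 'v) pers_mod" +
  assumes q_tame: "q_tame M"
begin

lemma minimal_subspace_of_image:
  assumes "p < q" "\<W> \<noteq> {}"
    and \<W>: "\<And>W. W \<in> \<W> \<Longrightarrow> submodule class_ring W (V q)" "\<And>W. W \<in> \<W> \<Longrightarrow> W \<subseteq> pm_im M p q"
  shows "\<exists>W\<in>\<W>. \<forall>U\<in>\<W>. U \<subseteq> W \<longrightarrow> U = W"
proof -
  let ?U = "(V q)\<lparr>carrier := pm_im M p q\<rparr>"
  have "submodule class_ring (pm_im M p q) (V q)" using submodule_pm_im \<open>p < q\<close> by simp
  then interpret U: vectorspace class_ring ?U
    using V.subspace_is_vs[OF subspace.intro[OF vectorspace_V]] by blast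
  have "submodule class_ring W ?U" if "W \<in> \<W>" for W
    using \<W>[OF that] U.module_axioms by (simp add: submodule_def)
  moreover have "U.fin_dim" using q_tame \<open>p < q\<close> by (simp add: q_tame_def)
  ultimately show ?thesis using \<open>\<W> \<noteq> {}\<close> U.minimal_submodule by blast
qed

lemma minimal_image:
  assumes S: "subfunctor S" and "p < q" and A: "A \<noteq> {}" "A \<subseteq> {..p}"
  obtains s where "s \<in> A" "\<And>r. r \<in> A \<Longrightarrow> r \<le> s \<Longrightarrow> T r q ` S r = T s q ` S s"
proof -
  have "\<exists>W\<in>(\<lambda>r. T r q ` S r) ` A. \<forall>U\<in>(\<lambda>r. T r q ` S r) ` A. U \<subseteq> W \<longrightarrow> U = W"
  proof (rule minimal_subspace_of_image[OF \<open>p < q\<close>])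
    show "(\<lambda>r. T r q ` S r) ` A \<noteq> {}" using A by simp
  next
    fix W assume "W \<in> (\<lambda>r. T r q ` S r) ` A"
    then obtain r where r: "r \<in> A" "W = T r q ` S r" by (elim imageE)
    have "r \<le> p" using r(1) A by auto
    then show "submodule class_ring W (V q)" "W \<subseteq> pm_im M p q"
      unfolding r(2) using submodule_image[OF S, of r q] image_antimono[OF S, of r p q]
        image_subset_pm_im[OF S, of p q] \<open>p < q\<close> by simp_all
  qed
  then obtain s where s: "s \<in> A"
    and min: "\<forall>r\<in>A. T r q ` S r \<subseteq> T s q ` S s \<longrightarrow> T r q ` S r = T s q ` S s"
    by (auto simp only: bex_simps ball_simps)
  have "s \<le> q" using s A \<open>p < q\<close> by auto
  then show thesis using min image_antimono[OF S] by (intro that[OF s]) simp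
qed

text \<open>The set \<open>B\<close> consists of the times from which something survives until \<open>q\<close>, and \<open>D s\<close> of the
  vectors at time \<open>s\<close> that have preimages at all earlier times of \<open>B\<close>. The maps between the spaces \<open>D s\<close>
  are surjective by the Mittag-Leffler argument, so a vector of \<open>D q\<close> can be lifted step by step along
  a sequence of times that is coinitial in \<open>B\<close>. The lifts determine the path at all times.\<close>

lemma oldest_path_exists:
  assumes S: "radical_subfunctor S" and "p < q" and z: "z \<in> S p" "T p q z \<noteq> \<zero>\<^bsub>V q\<^esub>"
  obtains y where "\<And>t. y t \<in> S t"
    "\<And>s t. s \<le> t \<Longrightarrow> y s \<noteq> \<zero>\<^bsub>V s\<^esub> \<Longrightarrow> T s t (y s) = y t"
    "y p \<noteq> \<zero>\<^bsub>V p\<^esub>" "y q \<noteq> \<zero>\<^bsub>V q\<^esub>"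
    "\<And>s x. s \<le> q \<Longrightarrow> y s = \<zero>\<^bsub>V s\<^esub> \<Longrightarrow> x \<in> S s \<Longrightarrow> T s q x = \<zero>\<^bsub>V q\<^esub>"
proof -
  note sf = radical_subfunctorD(1)[OF S]
  define B where "B = {s. s \<le> q \<and> (\<exists>x\<in>S s. T s q x \<noteq> \<zero>\<^bsub>V q\<^esub>)}"
  have pB: "p \<in> B" using z \<open>p < q\<close> by (auto simp: B_def)
  have Bq: "s \<le> q" if "s \<in> B" for s using that by (simp add: B_def)
  have B_up: "t \<in> B" if "s \<in> B" "s \<le> t" "t \<le> q" for s t
  proof -
    obtain x where x: "x \<in> S s" "T s q x \<noteq> \<zero>\<^bsub>V q\<^esub>" using \<open>s \<in> B\<close> by (auto simp: B_def)
    then have "T t q (T s t x) \<noteq> \<zero>\<^bsub>V q\<^esub>" "T s t x \<in> S t"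
      using that subfunctor_carrier[OF sf x(1)] subfunctor_T[OF sf \<open>s \<le> t\<close>] by (auto simp: map_comp)
    then show ?thesis using that by (auto simp: B_def)
  qed
  \<comment> \<open>Here it matters that \<open>S\<close> is its own radical: as \<open>B\<close> has no least element, every map needed
    below starts strictly earlier than it ends, and so has finite rank.\<close>
  have B_lower: "\<exists>r\<in>B. r < s" if "s \<in> B" for s
  proof -
    obtain x where x: "x \<in> S s" "T s q x \<noteq> \<zero>\<^bsub>V q\<^esub>" "s \<le> q" using \<open>s \<in> B\<close> by (auto simp: B_def)
    obtain r v where r: "r < s" "v \<in> S r" "x = T r s v"
      using radical_subfunctorD(2)[OF S x(1)] by blast
    have "T r q v \<noteq> \<zero>\<^bsub>V q\<^esub>"
      using x r subfunctor_carrier[OF sf r(2)] by (auto simp: map_comp)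
    then show ?thesis using r x(3) by (intro bexI[of _ r]) (auto simp: B_def)
  qed
  have qB: "q \<in> B" using B_up[OF pB] \<open>p < q\<close> by simp
  define D where "D s = (\<Inter>r\<in>{r\<in>B. r \<le> s}. T r s ` S r)" for s
  have DS: "D s \<subseteq> S s" if "s \<in> B" for s
  proof -
    have "D s \<subseteq> T s s ` S s" using that by (auto simp: D_def)
    also have "\<dots> \<subseteq> S s" using subfunctor_T[OF sf, of s s] by auto
    finally show ?thesis .
  qed
  \<comment> \<open>The images in \<open>S s'\<close> from times up to \<open>r1\<close> have a smallest member, the one from \<open>r0\<close>, and this
    is therefore contained in \<open>D s'\<close>. A preimage of \<open>x\<close> at time \<open>r0\<close> thus passes through \<open>D s'\<close>.\<close>
  have D_lift: "\<exists>v\<in>D s'. T s' s v = x" if "x \<in> D s" "s' \<in> B" "s' \<le> s" for x s s'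
  proof -
    obtain r1 where r1: "r1 \<in> B" "r1 < s'" using B_lower[OF \<open>s' \<in> B\<close>] by blast
    obtain r0 where r0: "r0 \<in> {r \<in> B. r \<le> r1}"
      "\<And>r. r \<in> {r \<in> B. r \<le> r1} \<Longrightarrow> r \<le> r0 \<Longrightarrow> T r s' ` S r = T r0 s' ` S r0"
      using minimal_image[OF sf r1(2), of "{r\<in>B. r \<le> r1}"] r1 by blast
    have "x \<in> T r0 s ` S r0" using that r0(1) r1(2) by (auto simp: D_def)
    then obtain v where v: "v \<in> S r0" "x = T r0 s v" by blast
    have "T r0 s' v \<in> T r s' ` S r" if r: "r \<in> B" "r \<le> s'" for r
    proof (cases "r \<le> r0")
      case True
      then show ?thesis using r0(1) r0(2)[of r] r v by auto
    next
      case False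
      then have "T r0 s' v = T r s' (T r0 r v)" "T r0 r v \<in> S r"
        using r subfunctor_carrier[OF sf v(1)] subfunctor_T[OF sf _ v(1), of r] by (auto simp: map_comp)
      then show ?thesis by blast
    qed
    then have "T r0 s' v \<in> D s'" by (auto simp: D_def)
    moreover have "T s' s (T r0 s' v) = x"
      using v subfunctor_carrier[OF sf v(1)] r0(1) r1(2) that(3) by (auto simp: map_comp)
    ultimately show ?thesis by blast
  qed
  \<comment> \<open>The smallest nonzero image in \<open>S q\<close> comes from all times of \<open>B\<close>.\<close>
  obtain w where w: "w \<in> D q" "w \<noteq> \<zero>\<^bsub>V q\<^esub>"
  proof -
    obtain s0 where s0: "s0 \<in> {s\<in>B. s \<le> p}"
      "\<And>r. r \<in> {s\<in>B. s \<le> p} \<Longrightarrow> r \<le> s0 \<Longrightarrow> T r q ` S r = T s0 q ` S s0"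
      using minimal_image[OF sf \<open>p < q\<close>, of "{s\<in>B. s \<le> p}"] pB by blast
    obtain x where x: "x \<in> S s0" "T s0 q x \<noteq> \<zero>\<^bsub>V q\<^esub>" using s0(1) by (auto simp: B_def)
    have "T s0 q x \<in> T r q ` S r" if r: "r \<in> B" for r
    proof (cases "r \<le> s0")
      case True
      then show ?thesis using s0(1) s0(2)[of r] x r by auto
    next
      case False
      then have "T s0 q x = T r q (T s0 r x)" "T s0 r x \<in> S r"
        using Bq[OF r] subfunctor_carrier[OF sf x(1)] subfunctor_T[OF sf _ x(1), of r] by (auto simp: map_comp)
      then show ?thesis by blast
    qed
    then show thesis using x by (intro that[of "T s0 q x"]) (auto simp: D_def)
  qed
  \<comment> \<open>Passing below the \<open>n\<close>-th rational in step \<open>n\<close>, if it belongs to \<open>B\<close>, makes the sequence of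
    times coinitial in \<open>B\<close>.\<close>
  define rat where "rat n = real_of_rat (from_nat n)" for n
  define lift_step where "lift_step n a b \<longleftrightarrow> fst b \<le> fst a \<and> (rat n \<in> B \<longrightarrow> fst b \<le> rat n) \<and>
    T (fst b) (fst a) (snd b) = snd a" for n and a b :: "real \<times> 'v"
  define good where "good n a \<longleftrightarrow> fst a \<in> B \<and> snd a \<in> D (fst a) \<and> (n = 0 \<longrightarrow> a = (q, w))"
    for n :: nat and a :: "real \<times> 'v"
  have "\<exists>f. \<forall>n. good n (f n) \<and> lift_step n (f n) (f (Suc n))"
  proof (rule dependent_nat_choice)
    show "\<exists>a. good 0 a" using qB w by (auto simp: good_def)
  next
    fix a :: "real \<times> 'v" and n :: nat
    assume "good n a"
    then have a: "fst a \<in> B" "snd a \<in> D (fst a)" by (simp_all add: good_def)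
    define s' where "s' = (if rat n \<in> B then min (fst a) (rat n) else fst a)"
    have s': "s' \<in> B" "s' \<le> fst a" "rat n \<in> B \<longrightarrow> s' \<le> rat n" using a by (auto simp: s'_def min_def)
    obtain v where v: "v \<in> D s'" "T s' (fst a) v = snd a" using D_lift[OF a(2) s'(1,2)] by blast
    show "\<exists>b. good (Suc n) b \<and> lift_step n a b"
      using s' v by (intro exI[of _ "(s', v)"]) (simp add: lift_step_def good_def)
  qed
  then obtain f where f: "\<And>n. good n (f n)" "\<And>n. lift_step n (f n) (f (Suc n))" by blast
  have fB: "fst (f n) \<in> B" and fD: "snd (f n) \<in> D (fst (f n))" and f0: "f 0 = (q, w)"
    and f_step: "lift_step n (f n) (f (Suc n))" for n
    using f(1)[of n] f(1)[of 0] f(2)[of n] by (simp_all add: good_def)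
  define \<sigma> v where "\<sigma> n = fst (f n)" and "v n = snd (f n)" for n
  have \<sigma>0: "\<sigma> 0 = q" "v 0 = w" using f0 by (auto simp: \<sigma>_def v_def)
  have vS: "v n \<in> S (\<sigma> n)" for n using fD fB DS by (auto simp: \<sigma>_def v_def)
  have vc: "v n \<in> carrier (V (\<sigma> n))" for n using subfunctor_carrier[OF sf vS] .
  have \<sigma>B: "\<sigma> n \<in> B" for n using fB by (simp add: \<sigma>_def)
  have \<sigma>_Suc: "\<sigma> (Suc n) \<le> \<sigma> n" for n
    using f_step[of n] by (simp add: \<sigma>_def lift_step_def)
  have \<sigma>_mono: "m \<le> n \<Longrightarrow> \<sigma> n \<le> \<sigma> m" for m n
    using lift_Suc_antimono_le[of \<sigma>, OF \<sigma>_Suc] .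
  have v_comp: "T (\<sigma> n) (\<sigma> m) (v n) = v m" if "m \<le> n" for m n
    using that
  proof (induction n rule: dec_induct)
    case base
    then show ?case using map_id[OF vc] .
  next
    case (step n)
    have "T (\<sigma> n) (\<sigma> m) (T (\<sigma> (Suc n)) (\<sigma> n) (v (Suc n))) = T (\<sigma> (Suc n)) (\<sigma> m) (v (Suc n))"
      using \<sigma>_mono step vc by (intro map_comp) auto
    moreover have "T (\<sigma> (Suc n)) (\<sigma> n) (v (Suc n)) = v n"
      using f_step[of n] by (simp add: \<sigma>_def v_def lift_step_def)
    ultimately show ?case using step by simp
  qed
  have \<sigma>_coinitial: "\<exists>n. \<sigma> n \<le> s" if "s \<in> B" for s
  proof -
    obtain r where r: "r \<in> B" "r < s" using B_lower[OF \<open>s \<in> B\<close>] by blast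
    obtain a where a: "r < of_rat a" "of_rat a < s" using of_rat_dense[OF r(2)] by blast
    have "rat (to_nat a) = of_rat a" by (simp add: rat_def)
    moreover have "of_rat a \<in> B" using B_up[OF r(1)] a Bq[OF that] by simp
    ultimately have "\<sigma> (Suc (to_nat a)) \<le> of_rat a"
      using f_step[of "to_nat a"] by (simp add: lift_step_def \<sigma>_def)
    then show ?thesis using a by (meson less_imp_le order_trans)
  qed
  define y where "y t = (if \<exists>n. \<sigma> n \<le> t then let n = (SOME n. \<sigma> n \<le> t) in T (\<sigma> n) t (v n)
    else \<zero>\<^bsub>V t\<^esub>)" for t
  have y_eq: "y t = T (\<sigma> n) t (v n)" if "\<sigma> n \<le> t" for n t
  proof -
    define m where "m = (SOME n. \<sigma> n \<le> t)"
    have m: "\<sigma> m \<le> t" unfolding m_def using that by (rule someI)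
    have "T (\<sigma> i) t (v i) = T (\<sigma> j) t (v j)" if "\<sigma> i \<le> t" "i \<le> j" for i j
      using v_comp[OF that(2)] map_comp[OF \<sigma>_mono[OF that(2)] that(1) vc] by simp
    then have "T (\<sigma> m) t (v m) = T (\<sigma> n) t (v n)"
      using m that by (cases m n rule: le_cases) simp_all
    then show ?thesis using that by (auto simp: y_def m_def)
  qed
  have y_zero: "y t = \<zero>\<^bsub>V t\<^esub>" if "\<not> (\<exists>n. \<sigma> n \<le> t)" for t
    using that by (simp add: y_def)
  have y_path: "T s t (y s) = y t" if "s \<le> t" "y s \<noteq> \<zero>\<^bsub>V s\<^esub>" for s t
  proof -
    obtain n where n: "\<sigma> n \<le> s" using \<open>y s \<noteq> _\<close> y_zero by blast
    then show ?thesis using y_eq[of n s] y_eq[of n t] that map_comp[OF n that(1) vc] by simp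
  qed
  have y_S: "y t \<in> S t" for t
  proof (cases "\<exists>n. \<sigma> n \<le> t")
    case True
    then obtain n where n: "\<sigma> n \<le> t" by blast
    then show ?thesis using y_eq[OF n] subfunctor_T[OF sf n vS] by simp
  qed (simp add: y_zero subfunctor_zero[OF sf])
  have y_nonzero: "y s \<noteq> \<zero>\<^bsub>V s\<^esub>" if "s \<in> B" for s
  proof -
    obtain n where n: "\<sigma> n \<le> s" using \<sigma>_coinitial[OF \<open>s \<in> B\<close>] by blast
    have "T s q (y s) = w"
      using y_eq[OF n] map_comp[OF n Bq[OF that] vc] v_comp[of 0 n] \<sigma>0 by simp
    then show ?thesis using w(2) T_zero[OF Bq[OF that]] by auto
  qed
  show thesis
  proof (rule that[of y])
    show "T s q x = \<zero>\<^bsub>V q\<^esub>" if "s \<le> q" "y s = \<zero>\<^bsub>V s\<^esub>" "x \<in> S s" for s x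
      using y_nonzero[of s] that by (auto simp: B_def)
  qed (use y_S y_path y_nonzero pB qB in auto)
qed

text \<open>The rank drops because \<open>y q\<close> is the image of \<open>y p\<close> but does not belong to \<open>S' q\<close>.\<close>

lemma interval_summand_exists:
  assumes S: "radical_subfunctor S" and "p < q" and z: "z \<in> S p" "T p q z \<noteq> \<zero>\<^bsub>V q\<^esub>"
  obtains y S' where "radical_subfunctor S'" "splits_off S y S'" "T p q ` S' p \<subset> T p q ` S p"
proof -
  obtain y where y: "\<And>t. y t \<in> S t"
    "\<And>s t. s \<le> t \<Longrightarrow> y s \<noteq> \<zero>\<^bsub>V s\<^esub> \<Longrightarrow> T s t (y s) = y t"
    "y p \<noteq> \<zero>\<^bsub>V p\<^esub>" "y q \<noteq> \<zero>\<^bsub>V q\<^esub>"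
    "\<And>s x. s \<le> q \<Longrightarrow> y s = \<zero>\<^bsub>V s\<^esub> \<Longrightarrow> x \<in> S s \<Longrightarrow> T s q x = \<zero>\<^bsub>V q\<^esub>"
    using oldest_path_exists[OF assms] by metis
  have "\<exists>S'. subfunctor S' \<and> splits_off S y S'"
  proof (rule complement_exists[OF radical_subfunctorD(1)[OF S] y(1)])
    show "T s t (y s) = y t" if "s \<le> t" "y s \<noteq> \<zero>\<^bsub>V s\<^esub>" for s t by (rule y(2)[OF that])
    show "y q \<noteq> \<zero>\<^bsub>V q\<^esub>" by (rule y(4))
    show "T s q x = \<zero>\<^bsub>V q\<^esub>" if "s \<le> q" "y s = \<zero>\<^bsub>V s\<^esub>" "x \<in> S s" for s x
      by (rule y(5)[OF that])
  qed blast
  then obtain S' where S': "subfunctor S'" "splits_off S y S'" by blast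
  have "T p q (y p) = y q" using y(2)[of p q] y(3) \<open>p < q\<close> by simp
  then have "y q \<in> T p q ` S p" using y(1)[of p] by (metis imageI)
  moreover have "y q \<notin> T p q ` S' p"
  proof -
    have "T p q ` S' p \<subseteq> S' q" using subfunctor_T[OF S'(1), of p q] \<open>p < q\<close> by auto
    then show ?thesis using S'(2) y(4) unfolding splits_off_def by blast
  qed
  moreover have "T p q ` S' p \<subseteq> T p q ` S p" using S'(2) unfolding splits_off_def by blast
  ultimately have "T p q ` S' p \<subset> T p q ` S p" by blast
  then show thesis using that splits_off_radical[OF S S'] S'(2) by blast
qed

end

section \<open>Expansions along a sequence of splittings\<close>

text \<open>Intervals are split off successively, the \<open>n\<close>-th one being spanned by the vectors \<open>y n t\<close>. By
  \<open>exhaust\<close>, every element comes from a time \<open>s\<close> such that, for some \<open>N\<close>, nothing in \<open>S N s\<close>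
  survives until \<open>t\<close>; this makes the expansions finite.\<close>

locale splitting_sequence = persistence_module M for M :: "('k :: field, 'v) pers_mod" +
  fixes S :: "nat \<Rightarrow> real \<Rightarrow> 'v set" and y :: "nat \<Rightarrow> real \<Rightarrow> 'v"
  assumes S: "subfunctor (S n)"
    and split: "splits_off (S n) (y n) (S (Suc n))"
    and exhaust: "v \<in> S 0 t \<Longrightarrow>
      \<exists>s\<le>t. \<exists>z\<in>S 0 s. v = T s t z \<and> (\<exists>N. \<forall>u\<in>S N s. T s t u = \<zero>\<^bsub>V t\<^esub>)"
begin

lemma y_S: "y n t \<in> S n t"
  and y_fresh: "y n t \<in> S (Suc n) t \<Longrightarrow> y n t = \<zero>\<^bsub>V t\<^esub>"
  and S_Suc: "S (Suc n) t \<subseteq> S n t"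
  and S_adjoin: "S n t \<subseteq> adjoin (V t) (S (Suc n) t) (y n t)"
  and y_path: "s \<le> t \<Longrightarrow> y n s \<noteq> \<zero>\<^bsub>V s\<^esub> \<Longrightarrow> T s t (y n s) = y n t"
  using split[of n] unfolding splits_off_def by blast+

lemma S_carrier: "v \<in> S n t \<Longrightarrow> v \<in> carrier (V t)"
  using subfunctor_carrier[OF S] .

lemma y_carrier: "y n t \<in> carrier (V t)"
  using S_carrier[OF y_S] .

text \<open>Here \<open>x n\<close> is the coefficient of \<open>v\<close> along \<open>y n t\<close>, and \<open>r n\<close> is the component of \<open>v\<close> in \<open>S n t\<close>.
  Carrying the remainders along replaces infinite sums; uniqueness, linearity and naturality of the
  coefficients can be checked at each single splitting. The last clause normalizes the
  coefficient where the interval is absent.\<close>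

definition expansion :: "real \<Rightarrow> 'v \<Rightarrow> (nat \<Rightarrow> 'k) \<Rightarrow> (nat \<Rightarrow> 'v) \<Rightarrow> bool" where
  "expansion t v x r \<longleftrightarrow> r 0 = v \<and> (\<forall>n. r n \<in> S n t \<and>
    r n = x n \<odot>\<^bsub>V t\<^esub> y n t \<oplus>\<^bsub>V t\<^esub> r (Suc n) \<and> (y n t = \<zero>\<^bsub>V t\<^esub> \<longrightarrow> x n = 0))"

lemma expansionD:
  assumes "expansion t v x r"
  shows "r 0 = v" "r n \<in> S n t" "r n \<in> carrier (V t)"
    "r n = x n \<odot>\<^bsub>V t\<^esub> y n t \<oplus>\<^bsub>V t\<^esub> r (Suc n)" "y n t = \<zero>\<^bsub>V t\<^esub> \<Longrightarrow> x n = 0"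
proof -
  show "r 0 = v" "r n = x n \<odot>\<^bsub>V t\<^esub> y n t \<oplus>\<^bsub>V t\<^esub> r (Suc n)"
    and n: "r n \<in> S n t" and "y n t = \<zero>\<^bsub>V t\<^esub> \<Longrightarrow> x n = 0"
    using assms unfolding expansion_def by blast+
  show "r n \<in> carrier (V t)" using n by (rule S_carrier)
qed

lemma expansion_step_unique:
  assumes "p \<in> S (Suc n) t" "p' \<in> S (Suc n) t"
    and "c \<odot>\<^bsub>V t\<^esub> y n t \<oplus>\<^bsub>V t\<^esub> p = c' \<odot>\<^bsub>V t\<^esub> y n t \<oplus>\<^bsub>V t\<^esub> p'"
    and "y n t = \<zero>\<^bsub>V t\<^esub> \<Longrightarrow> c = 0" "y n t = \<zero>\<^bsub>V t\<^esub> \<Longrightarrow> c' = 0"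
  shows "c = c' \<and> p = p'"
  using adjoin_decomposition_unique[OF vectorspace_V subfunctor_sub[OF S] y_carrier assms(1-3)]
    y_fresh assms(4,5) by simp

lemma expansion_exists:
  assumes "v \<in> S 0 t"
  obtains x r where "expansion t v x r"
proof -
  define P where "P n u c u' \<longleftrightarrow> (u \<in> S n t \<longrightarrow> u' \<in> S (Suc n) t \<and>
    u = c \<odot>\<^bsub>V t\<^esub> y n t \<oplus>\<^bsub>V t\<^esub> u' \<and> (y n t = \<zero>\<^bsub>V t\<^esub> \<longrightarrow> c = 0))" for n u c u'
  have ex: "\<exists>c u'. P n u c u'" for n u
  proof (cases "u \<in> S n t")
    case True
    then obtain c u' where u: "u' \<in> S (Suc n) t" "u = c \<odot>\<^bsub>V t\<^esub> y n t \<oplus>\<^bsub>V t\<^esub> u'"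
      using S_adjoin[of n t] unfolding adjoin_def by blast
    show ?thesis
    proof (cases "y n t = \<zero>\<^bsub>V t\<^esub>")
      case True
      then have "u = 0 \<odot>\<^bsub>V t\<^esub> y n t \<oplus>\<^bsub>V t\<^esub> u'"
        using u V.smult_r_null[of c t] V.smult_r_null[of 0 t] by simp
      then have "P n u 0 u'" using u(1) unfolding P_def by blast
      then show ?thesis by blast
    next
      case False
      then have "P n u c u'" using u unfolding P_def by blast
      then show ?thesis by blast
    qed
  qed (simp add: P_def)
  obtain c r' where "\<And>n u. P n u (c n u) (r' n u)"
    using ex by metis
  then have step: "r' n u \<in> S (Suc n) t \<and>
      u = c n u \<odot>\<^bsub>V t\<^esub> y n t \<oplus>\<^bsub>V t\<^esub> r' n u \<and> (y n t = \<zero>\<^bsub>V t\<^esub> \<longrightarrow> c n u = 0)"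
    if "u \<in> S n t" for n u
    using that unfolding P_def by blast
  define r where "r = rec_nat v r'"
  have r: "r 0 = v" "r (Suc n) = r' n (r n)" for n by (simp_all add: r_def)
  have rS: "r n \<in> S n t" for n
    by (induction n) (use assms step r in auto)
  have "expansion t v (\<lambda>n. c n (r n)) r"
    unfolding expansion_def r(2) using step[OF rS] rS r(1) by blast
  then show thesis by (rule that)
qed

lemma expansion_unique:
  assumes e: "expansion t v x r" and e': "expansion t v x' r'"
  shows "x = x' \<and> r = r'"
proof -
  have step: "x n = x' n \<and> r (Suc n) = r' (Suc n)" if "r n = r' n" for n
  proof (rule expansion_step_unique)
    show "r (Suc n) \<in> S (Suc n) t" "r' (Suc n) \<in> S (Suc n) t"
      by (rule expansionD(2)[OF e], rule expansionD(2)[OF e'])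
    show "x n \<odot>\<^bsub>V t\<^esub> y n t \<oplus>\<^bsub>V t\<^esub> r (Suc n) = x' n \<odot>\<^bsub>V t\<^esub> y n t \<oplus>\<^bsub>V t\<^esub> r' (Suc n)"
      using that unfolding expansionD(4)[OF e, of n] expansionD(4)[OF e', of n] .
  qed (fact expansionD(5)[OF e], fact expansionD(5)[OF e'])
  have "r n = r' n" for n
    by (induction n) (simp_all add: step expansionD(1)[OF e] expansionD(1)[OF e'])
  then show ?thesis using step by blast
qed

lemma expansion_add:
  assumes e: "expansion t v x r" and e': "expansion t v' x' r'"
  shows "expansion t (v \<oplus>\<^bsub>V t\<^esub> v') (\<lambda>n. x n + x' n) (\<lambda>n. r n \<oplus>\<^bsub>V t\<^esub> r' n)"
  unfolding expansion_def
proof (intro conjI allI impI)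
  fix n
  show "r 0 \<oplus>\<^bsub>V t\<^esub> r' 0 = v \<oplus>\<^bsub>V t\<^esub> v'"
    using expansionD(1)[OF e] expansionD(1)[OF e'] by simp
  show "r n \<oplus>\<^bsub>V t\<^esub> r' n \<in> S n t"
    using expansionD(2)[OF e] expansionD(2)[OF e'] by (rule subfunctor_add[OF S])
  show "y n t = \<zero>\<^bsub>V t\<^esub> \<Longrightarrow> x n + x' n = 0"
    using expansionD(5)[OF e] expansionD(5)[OF e'] by simp
  show "r n \<oplus>\<^bsub>V t\<^esub> r' n = (x n + x' n) \<odot>\<^bsub>V t\<^esub> y n t \<oplus>\<^bsub>V t\<^esub>
      (r (Suc n) \<oplus>\<^bsub>V t\<^esub> r' (Suc n))"
    unfolding expansionD(4)[OF e, of n] expansionD(4)[OF e', of n]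
    using expansionD(3)[OF e] expansionD(3)[OF e'] y_carrier
    by (simp add: scalar V.a_ac)
qed

lemma expansion_smult:
  assumes e: "expansion t v x r"
  shows "expansion t (c \<odot>\<^bsub>V t\<^esub> v) (\<lambda>n. c * x n) (\<lambda>n. c \<odot>\<^bsub>V t\<^esub> r n)"
  unfolding expansion_def
proof (intro conjI allI impI)
  fix n
  show "c \<odot>\<^bsub>V t\<^esub> r 0 = c \<odot>\<^bsub>V t\<^esub> v" using expansionD(1)[OF e] by simp
  show "c \<odot>\<^bsub>V t\<^esub> r n \<in> S n t" using expansionD(2)[OF e] by (rule subfunctor_smult[OF S])
  show "y n t = \<zero>\<^bsub>V t\<^esub> \<Longrightarrow> c * x n = 0" using expansionD(5)[OF e] by simp
  show "c \<odot>\<^bsub>V t\<^esub> r n = (c * x n) \<odot>\<^bsub>V t\<^esub> y n t \<oplus>\<^bsub>V t\<^esub> c \<odot>\<^bsub>V t\<^esub> r (Suc n)"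
    by (subst expansionD(4)[OF e, of n]) (use expansionD(3)[OF e] y_carrier in \<open>simp add: scalar\<close>)
qed

text \<open>The structure map sends \<open>y n s\<close> to \<open>y n t\<close> if both are nonzero. A coefficient is lost exactly if the
  \<open>n\<close>-th interval has ended by \<open>t\<close>, and none is gained as \<open>x n = 0\<close> before the interval begins.\<close>

lemma expansion_T:
  assumes e: "expansion s v x r" and "s \<le> t"
  shows "expansion t (T s t v) (\<lambda>n. if y n t = \<zero>\<^bsub>V t\<^esub> then 0 else x n) (\<lambda>n. T s t (r n))"
  unfolding expansion_def
proof (intro conjI allI impI)
  fix n
  show "T s t (r 0) = T s t v" using expansionD(1)[OF e] by simp
  show "T s t (r n) \<in> S n t" using expansionD(2)[OF e] \<open>s \<le> t\<close> subfunctor_T[OF S] by simp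
  let ?x = "if y n t = \<zero>\<^bsub>V t\<^esub> then 0 else x n"
  show "y n t = \<zero>\<^bsub>V t\<^esub> \<Longrightarrow> ?x = 0" by simp
  have "x n \<odot>\<^bsub>V t\<^esub> T s t (y n s) = ?x \<odot>\<^bsub>V t\<^esub> y n t"
  proof (cases "y n s = \<zero>\<^bsub>V s\<^esub>")
    case True
    then show ?thesis
      using expansionD(5)[OF e] \<open>s \<le> t\<close> y_carrier[of n t] by (simp add: scalar T_zero)
  next
    case False
    then show ?thesis
      using y_path[OF \<open>s \<le> t\<close> False] V.smult_r_null[of "x n" t] V.smult_r_null[of 0 t] by simp
  qed
  then show "T s t (r n) = ?x \<odot>\<^bsub>V t\<^esub> y n t \<oplus>\<^bsub>V t\<^esub> T s t (r (Suc n))"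
    by (subst expansionD(4)[OF e, of n])
       (use expansionD(3)[OF e] y_carrier \<open>s \<le> t\<close> in \<open>simp add: scalar T_add T_smult\<close>)
qed

text \<open>Write \<open>v\<close> as the image of an earlier \<open>z\<close> by \<open>exhaust\<close>. By naturality and uniqueness, the remainders
  of \<open>v\<close> are the images of the remainders of \<open>z\<close>, and these die.\<close>

lemma expansion_terminates:
  assumes e: "expansion t v x r"
  obtains N where "\<And>n. n \<ge> N \<Longrightarrow> r n = \<zero>\<^bsub>V t\<^esub> \<and> x n = 0"
proof -
  have "v \<in> S 0 t" using expansionD(1,2)[OF e] by metis
  then obtain s z N where s: "s \<le> t" "z \<in> S 0 s" "v = T s t z"
    and N: "\<And>u. u \<in> S N s \<Longrightarrow> T s t u = \<zero>\<^bsub>V t\<^esub>"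
    using exhaust by blast
  obtain x' r' where e': "expansion s z x' r'" using expansion_exists[OF s(2)] .
  have rT: "r n = T s t (r' n)" for n
    using expansion_unique[OF e expansion_T[OF e' s(1), folded s(3)]] by simp
  have rz: "r n = \<zero>\<^bsub>V t\<^esub>" if "n \<ge> N" for n
  proof -
    have "S n s \<subseteq> S N s" using lift_Suc_antimono_le[of "\<lambda>n. S n s"] S_Suc that by blast
    then show ?thesis using N expansionD(2)[OF e'] rT by auto
  qed
  have "x n = 0" if "n \<ge> N" for n
  proof -
    have "x n \<odot>\<^bsub>V t\<^esub> y n t \<oplus>\<^bsub>V t\<^esub> \<zero>\<^bsub>V t\<^esub> = 0 \<odot>\<^bsub>V t\<^esub> y n t \<oplus>\<^bsub>V t\<^esub> \<zero>\<^bsub>V t\<^esub>"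
      using expansionD(4)[OF e, of n] rz[of n] rz[of "Suc n"] that y_carrier by (simp add: scalar)
    then show ?thesis
      using expansion_step_unique[OF subfunctor_zero[OF S] subfunctor_zero[OF S]]
        expansionD(5)[OF e] by blast
  qed
  with rz show thesis using that by blast
qed

lemma expansion_surj:
  assumes fin: "finite {n. x n \<noteq> 0}" and x: "\<And>n. y n t = \<zero>\<^bsub>V t\<^esub> \<Longrightarrow> x n = 0"
  obtains v r where "expansion t v x r"
proof -
  obtain N where N: "\<And>n. n \<ge> N \<Longrightarrow> x n = 0"
    using finite_nat_set_iff_bounded[THEN iffD1, OF fin] by (metis mem_Collect_eq not_less)
  \<comment> \<open>The remainder \<open>r n\<close> is the tail of the sum from \<open>n\<close> on, which is built up backwards from \<open>N\<close>.\<close>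
  define f where "f = rec_nat \<zero>\<^bsub>V t\<^esub> (\<lambda>k u. x (N - Suc k) \<odot>\<^bsub>V t\<^esub> y (N - Suc k) t \<oplus>\<^bsub>V t\<^esub> u)"
  have f: "f 0 = \<zero>\<^bsub>V t\<^esub>"
    "f (Suc k) = x (N - Suc k) \<odot>\<^bsub>V t\<^esub> y (N - Suc k) t \<oplus>\<^bsub>V t\<^esub> f k" for k
    by (simp_all add: f_def)
  have fS: "f k \<in> S (N - k) t" if "k \<le> N" for k
    using that
  proof (induction k)
    case 0
    show ?case using f subfunctor_zero[OF S] by simp
  next
    case (Suc k)
    have "N - k = Suc (N - Suc k)" using Suc by simp
    then have "f k \<in> S (N - Suc k) t" using Suc S_Suc[of "N - Suc k" t] by auto
    then show ?case unfolding f by (intro subfunctor_add[OF S] subfunctor_smult[OF S] y_S)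
  qed
  define r where "r n = f (N - n)" for n
  have "expansion t (r 0) x r"
    unfolding expansion_def
  proof (intro conjI allI impI refl x)
    fix n
    show "r n \<in> S n t"
      using fS[of "N - n"] f subfunctor_zero[OF S, of t n] by (cases "n \<le> N") (auto simp: r_def)
    then have rc: "r n \<in> carrier (V t)" by (rule S_carrier)
    show "r n = x n \<odot>\<^bsub>V t\<^esub> y n t \<oplus>\<^bsub>V t\<^esub> r (Suc n)"
    proof (cases "n < N")
      case True
      then have "N - n = Suc (N - Suc n)" "N - Suc (N - Suc n) = n" by simp_all
      then show ?thesis using f(2)[of "N - Suc n"] by (simp add: r_def)
    next
      case False
      then show ?thesis using N[of n] y_carrier by (simp add: r_def f scalar)
    qed
  qed
  then show thesis by (rule that)
qed

definition coef :: "real \<Rightarrow> 'v \<Rightarrow> nat \<Rightarrow> 'k" where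
  "coef t v = (THE x. \<exists>r. expansion t v x r)"

lemma coef_eq: "expansion t v x r \<Longrightarrow> coef t v = x"
  unfolding coef_def using expansion_unique by blast

definition J :: "nat \<Rightarrow> real set" where
  "J n = {t. y n t \<noteq> \<zero>\<^bsub>V t\<^esub>}"

lemma is_interval_J: "is_interval (J n)"
  unfolding is_interval_1
proof (intro ballI allI impI)
  fix a b c assume "a \<in> J n" "b \<in> J n" "a \<le> c \<and> c \<le> b"
  then have "y n c = T a c (y n a)" "y n b = T a b (y n a)" "y n b = T c b (T a c (y n a))"
    using y_path[of a c n] y_path[of a b n] map_comp[of a c b "y n a"] y_carrier[of n a]
    by (auto simp: J_def)
  then show "c \<in> J n"
    using \<open>b \<in> J n\<close> T_zero[of c b] \<open>a \<le> c \<and> c \<le> b\<close> by (auto simp: J_def)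
qed

end

section \<open>Direct sums of interval modules\<close>

lemma direct_sum_interval_simps:
  defines "D \<equiv> \<lambda>I J t. pm_space (pm_direct_sum I (\<lambda>i. interval_module (J i) :: ('k :: field, 'k) pers_mod)) t"
  shows "carrier (D I J t) =
      {x \<in> I \<rightarrow>\<^sub>E UNIV. (\<forall>i\<in>I. t \<notin> J i \<longrightarrow> x i = 0) \<and> finite {i \<in> I. x i \<noteq> 0}}"
    and "\<zero>\<^bsub>D I J t\<^esub> = (\<lambda>i\<in>I. 0)"
    and "x \<oplus>\<^bsub>D I J t\<^esub> x' = (\<lambda>i\<in>I. x i + x' i)"
    and "c \<odot>\<^bsub>D I J t\<^esub> x = (\<lambda>i\<in>I. c * x i)"
  by (auto simp: D_def pm_direct_sum_def interval_module_def PiE_iff split: if_splits)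

lemma vectorspace_direct_sum_interval:
  fixes I :: "'i set"
  shows "vectorspace class_ring
    (pm_space (pm_direct_sum I (\<lambda>i. interval_module (J i) :: ('k :: field, 'k) pers_mod)) t)"
proof -
  let ?fin = "\<lambda>x :: 'i \<Rightarrow> 'k. finite {i \<in> I. x i \<noteq> 0}"
  have fin_add: "finite {i \<in> I. x i + x' i \<noteq> 0}" if "?fin x" "?fin x'" for x x' :: "'i \<Rightarrow> 'k"
    using finite_subset[OF _ finite_UnI[OF that]] by (smt (verit) Un_iff add_0 mem_Collect_eq subsetI)
  have fin_mult: "finite {i \<in> I. c \<noteq> 0 \<and> x i \<noteq> 0}" if "?fin x" for c and x :: "'i \<Rightarrow> 'k"
    by (rule finite_subset[OF _ that]) auto
  show ?thesis
  proof (rule vs_criteria, goal_cases)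
    case 1
    show ?case by (rule class_field)
  next
    case 4
    show ?case
    proof
      fix x assume x: "x \<in> carrier (pm_space (pm_direct_sum I
        (\<lambda>i. interval_module (J i) :: ('k, 'k) pers_mod)) t)"
      show "\<exists>x'\<in>carrier (pm_space (pm_direct_sum I (\<lambda>i. interval_module (J i))) t).
        x \<oplus>\<^bsub>pm_space (pm_direct_sum I (\<lambda>i. interval_module (J i))) t\<^esub> x' =
          \<zero>\<^bsub>pm_space (pm_direct_sum I (\<lambda>i. interval_module (J i))) t\<^esub>"
        using x by (intro bexI[of _ "\<lambda>i\<in>I. - x i"])
          (auto simp: direct_sum_interval_simps fun_eq_iff cong: conj_cong)
    qed
  qed (auto simp: direct_sum_interval_simps fin_add fin_mult algebra_simps PiE_iff extensional_def
      fun_eq_iff cong: conj_cong)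
qed

section \<open>The coefficients as an isomorphism\<close>

context splitting_sequence
begin

definition index :: "nat set" where
  "index = {n. J n \<noteq> {}}"

definition coords :: "real \<Rightarrow> 'v \<Rightarrow> nat \<Rightarrow> 'k" where
  "coords t v = restrict (coef t v) index"

abbreviation "interval_sum \<equiv> pm_direct_sum index (\<lambda>n. interval_module (J n) :: ('k, 'k) pers_mod)"

lemma coords_eq: "expansion t v x r \<Longrightarrow> coords t v = restrict x index"
  by (simp add: coords_def coef_eq)

lemma expansion_outside: "expansion t v x r \<Longrightarrow> t \<notin> J n \<Longrightarrow> x n = 0"
  "expansion t v x r \<Longrightarrow> n \<notin> index \<Longrightarrow> x n = 0"
  using expansionD(5) by (auto simp: J_def index_def)

text \<open>Two elements with the same coefficients agree because both remainders vanish late, and an equality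
  of remainders at \<open>n + 1\<close> is inherited by \<open>n\<close>.\<close>

lemma coords_bij: "bij_betw (coords t) (S 0 t) (carrier (pm_space interval_sum t))"
proof (intro bij_betw_imageI inj_onI subset_antisym subsetI)
  fix v v' assume "v \<in> S 0 t" "v' \<in> S 0 t" and eq: "coords t v = coords t v'"
  then obtain x r x' r' where e: "expansion t v x r" and e': "expansion t v' x' r'"
    using expansion_exists by metis
  have "x n = x' n" for n
    using eq[unfolded coords_eq[OF e] coords_eq[OF e'], THEN fun_cong, of n]
      expansion_outside(2)[OF e, of n] expansion_outside(2)[OF e', of n] by (cases "n \<in> index") auto
  moreover obtain N N' where N: "\<And>n. n \<ge> N \<Longrightarrow> r n = \<zero>\<^bsub>V t\<^esub> \<and> x n = 0"
    and N': "\<And>n. n \<ge> N' \<Longrightarrow> r' n = \<zero>\<^bsub>V t\<^esub> \<and> x' n = 0"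
    using expansion_terminates[OF e] expansion_terminates[OF e'] by metis
  have "r n = r' n" if "n \<le> max N N'" for n
    using that
  proof (induction n rule: inc_induct)
    case base
    then show ?case using N[of "max N N'"] N'[of "max N N'"] by simp
  next
    case (step n)
    then show ?case
      using expansionD(4)[OF e, of n] expansionD(4)[OF e', of n] \<open>x n = x' n\<close> by presburger
  qed
  from this[of 0] show "v = v'" using expansionD(1)[OF e] expansionD(1)[OF e'] by simp
next
  fix a assume "a \<in> coords t ` S 0 t"
  then obtain v where "v \<in> S 0 t" and a: "a = coords t v" by blast
  then obtain x r where e: "expansion t v x r" using expansion_exists by metis
  obtain N where N: "\<And>n. n \<ge> N \<Longrightarrow> r n = \<zero>\<^bsub>V t\<^esub> \<and> x n = 0"
    using expansion_terminates[OF e] by metis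
  have "{n \<in> index. x n \<noteq> 0} \<subseteq> {..<N}" using N by (auto simp: not_le[symmetric])
  then have "finite {n \<in> index. x n \<noteq> 0}" using finite_subset by blast
  then show "a \<in> carrier (pm_space interval_sum t)"
    unfolding a coords_eq[OF e] using expansion_outside(1)[OF e]
    by (auto simp: direct_sum_interval_simps cong: conj_cong)
next
  fix a assume a: "a \<in> carrier (pm_space interval_sum t)"
  define x where "x n = (if n \<in> index then a n else 0)" for n
  have "{n. x n \<noteq> 0} = {n \<in> index. a n \<noteq> 0}" by (auto simp: x_def)
  then have "finite {n. x n \<noteq> 0}" using a by (simp add: direct_sum_interval_simps)
  moreover have "x n = 0" if "y n t = \<zero>\<^bsub>V t\<^esub>" for n
    using that a by (auto simp: x_def direct_sum_interval_simps J_def)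
  ultimately obtain v r where e: "expansion t v x r" using expansion_surj by metis
  have "restrict x index = a"
    using a by (auto simp: x_def direct_sum_interval_simps PiE_iff extensional_def fun_eq_iff)
  moreover have "v \<in> S 0 t" using expansionD(1,2)[OF e] by metis
  ultimately show "a \<in> coords t ` S 0 t" using coords_eq[OF e] by (metis imageI)
qed

lemma coords_add: "v \<in> S 0 t \<Longrightarrow> v' \<in> S 0 t \<Longrightarrow>
    coords t (v \<oplus>\<^bsub>V t\<^esub> v') = coords t v \<oplus>\<^bsub>pm_space interval_sum t\<^esub> coords t v'"
  and coords_smult: "v \<in> S 0 t \<Longrightarrow> coords t (c \<odot>\<^bsub>V t\<^esub> v) = c \<odot>\<^bsub>pm_space interval_sum t\<^esub> coords t v"
  and coords_T: "s \<le> t \<Longrightarrow> u \<in> S 0 s \<Longrightarrow> coords t (T s t u) = pm_map interval_sum s t (coords s u)"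
proof -
  assume "v \<in> S 0 t"
  then obtain x r where e: "expansion t v x r" using expansion_exists by metis
  show "coords t (c \<odot>\<^bsub>V t\<^esub> v) = c \<odot>\<^bsub>pm_space interval_sum t\<^esub> coords t v"
    using coords_eq[OF e] coords_eq[OF expansion_smult[OF e]] by (auto simp: direct_sum_interval_simps)
  assume "v' \<in> S 0 t"
  then obtain x' r' where e': "expansion t v' x' r'" using expansion_exists by metis
  show "coords t (v \<oplus>\<^bsub>V t\<^esub> v') = coords t v \<oplus>\<^bsub>pm_space interval_sum t\<^esub> coords t v'"
    using coords_eq[OF e] coords_eq[OF e'] coords_eq[OF expansion_add[OF e e']]
    by (auto simp: direct_sum_interval_simps)
next
  assume "s \<le> t" "u \<in> S 0 s"
  then obtain x r where e: "expansion s u x r" using expansion_exists by metis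
  show "coords t (T s t u) = pm_map interval_sum s t (coords s u)"
    using coords_eq[OF e] coords_eq[OF expansion_T[OF e \<open>s \<le> t\<close>]] expansion_outside(1)[OF e]
    by (auto simp: pm_direct_sum_def interval_module_def J_def)
qed

lemma decomposition:
  assumes "\<And>t. pm_space N t = (V t)\<lparr>carrier := S 0 t\<rparr>" and "pm_map N = T"
  shows "pm_isomorphic N interval_sum"
proof -
  have vs: "vectorspace class_ring (pm_space N t)" for t
    unfolding assms(1) using V.subspace_is_vs[OF subspace.intro] vectorspace_V subfunctor_sub[OF S] by blast
  have "linear_map class_ring (pm_space N t) (pm_space interval_sum t) (coords t)" for t
  proof (intro linear_map.intro mod_hom.intro mod_hom_axioms.intro vectorspace.axioms(1) vs
      vectorspace_direct_sum_interval)
    show "coords t \<in> module_hom class_ring (pm_space N t) (pm_space interval_sum t)"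
      using coords_bij[of t] by (auto simp: module_hom_def assms coords_add coords_smult bij_betw_def)
  qed
  then have "pm_iso N interval_sum coords"
    using coords_bij coords_T by (simp add: pm_iso_def assms)
  then show ?thesis by (auto simp: pm_isomorphic_def)
qed

end

section \<open>Exhausting the radical\<close>

context q_tame_module
begin

definition rad_space :: "real \<Rightarrow> 'v set" where
  "rad_space t = (\<Union>s\<in>{..<t}. pm_im M s t)"

lemma images_directed:
  assumes "finite C" "C \<subseteq> {..<t}"
  obtains s where "s < t" "\<And>c. c \<in> C \<Longrightarrow> pm_im M c t \<subseteq> pm_im M s t"
proof (rule that[of "Max (insert (t - 1) C)"])
  show lt: "Max (insert (t - 1) C) < t" using assms by (subst Max_less_iff) auto
  show "pm_im M c t \<subseteq> pm_im M (Max (insert (t - 1) C)) t" if "c \<in> C" for c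
    using assms that lt by (intro pm_im_mono) auto
qed

text \<open>The images \<open>im M(s < t)\<close> form a chain, so their sum is their union.\<close>

lemma rad_carrier: "pm_space (rad M) t = (V t)\<lparr>carrier := rad_space t\<rparr>"
proof -
  have "finsum (V t) x C \<in> rad_space t" if C: "finite C" "C \<subseteq> {..<t}" "\<forall>c\<in>C. x c \<in> pm_im M c t" for x C
  proof -
    obtain s where s: "s < t" "\<And>c. c \<in> C \<Longrightarrow> pm_im M c t \<subseteq> pm_im M s t"
      using images_directed[OF C(1,2)] by metis
    note sub = submodule_pm_im[of s t]
    have "x \<in> C \<rightarrow> pm_im M s t" using C(3) s(2) by blast
    with C(1) have "finsum (V t) x C \<in> pm_im M s t"
    proof (induction C)
      case empty
      then show ?case using sub s by (simp add: submodule_def)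
    next
      case (insert c C)
      moreover have "pm_im M s t \<subseteq> carrier (V t)" using sub s by (simp add: submodule_def)
      ultimately have "x \<in> C \<rightarrow> carrier (V t)" "x c \<in> carrier (V t)" by auto
      then show ?case using insert sub s by (simp add: submodule_def)
    qed
    then show ?thesis using s by (auto simp: rad_space_def)
  qed
  moreover have "\<exists>x C. v = finsum (V t) x C \<and> finite C \<and> C \<subseteq> {..<t} \<and> (\<forall>c\<in>C. x c \<in> pm_im M c t)"
    if v: "v \<in> rad_space t" for v
  proof -
    obtain s where s: "s < t" "v \<in> pm_im M s t" using v by (auto simp: rad_space_def)
    have "v \<in> carrier (V t)" using submodule_pm_im[of s t] s by (auto simp: submodule_def)
    then have "v = finsum (V t) (\<lambda>_. v) {s}" by simp
    then show ?thesis using s by (intro exI[of _ "\<lambda>_. v"] exI[of _ "{s}"]) auto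
  qed
  ultimately have "{finsum (V t) x C | x C. finite C \<and> C \<subseteq> {..<t} \<and> (\<forall>c\<in>C. x c \<in> pm_im M c t)} = rad_space t"
    by blast
  then show ?thesis by (simp add: rad_def)
qed

lemma radical_subfunctor_rad_space: "radical_subfunctor rad_space"
  unfolding radical_subfunctor_def subfunctor_def
proof (intro conjI allI impI)
  fix t
  show "submodule class_ring (rad_space t) (V t)"
  proof
    have mem_rad: "v \<in> rad_space t" if "s < t" "v \<in> pm_im M s t" for s v using that by (auto simp: rad_space_def)
    have sub: "submodule class_ring (pm_im M s t) (V t)" if "s < t" for s
      using submodule_pm_im that by simp
    show "rad_space t \<subseteq> carrier (V t)"
      unfolding rad_space_def using submodule.subset[OF sub] by (intro UN_least) simp
    show "\<zero>\<^bsub>V t\<^esub> \<in> rad_space t"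
      using mem_rad[of "t - 1"] submodule.zero_closed[OF sub, of "t - 1"] by simp
    fix v assume "v \<in> rad_space t"
    then obtain s where s: "s < t" "v \<in> pm_im M s t" by (auto simp: rad_space_def)
    show "c \<odot>\<^bsub>V t\<^esub> v \<in> rad_space t" for c
      by (rule mem_rad[OF s(1)], rule submodule.smult_closed[OF sub[OF s(1)] _ s(2)]) simp
    fix w assume "w \<in> rad_space t"
    then obtain s' where s': "s' < t" "w \<in> pm_im M s' t" by (auto simp: rad_space_def)
    then have "v \<in> pm_im M (max s s') t" "w \<in> pm_im M (max s s') t"
      using s pm_im_mono[of s "max s s'" t] pm_im_mono[of s' "max s s'" t] by auto
    then show "v \<oplus>\<^bsub>V t\<^esub> w \<in> rad_space t"
      using mem_rad[of "max s s'"] submodule.m_closed[OF sub, of "max s s'"] s(1) s'(1) by simp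
  qed
next
  fix s t :: real assume "s \<le> t"
  show "T s t ` rad_space s \<subseteq> rad_space t"
  proof
    fix v assume "v \<in> T s t ` rad_space s"
    then obtain r z where r: "r < s" "z \<in> carrier (V r)" "v = T s t (T r s z)"
      by (auto simp: rad_space_def pm_im_def)
    then have "v = T r t z" using map_comp \<open>s \<le> t\<close> by simp
    then show "v \<in> rad_space t" using r \<open>s \<le> t\<close> by (auto simp: rad_space_def pm_im_def intro!: bexI[of _ r])
  qed
next
  fix t
  show "rad_space t \<subseteq> (\<Union>s\<in>{..<t}. T s t ` rad_space s)"
  proof
    fix v assume "v \<in> rad_space t"
    then obtain r z where r: "r < t" "z \<in> carrier (V r)" "v = T r t z"
      by (auto simp: rad_space_def pm_im_def)
    obtain s where s: "r < s" "s < t" using dense[OF r(1)] by blast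
    have "v = T s t (T r s z)" using r s by (simp add: map_comp)
    moreover have "T r s z \<in> rad_space s" using r s by (auto simp: rad_space_def pm_im_def intro!: bexI[of _ r])
    ultimately show "v \<in> (\<Union>s\<in>{..<t}. T s t ` rad_space s)" using s by blast
  qed
qed

text \<open>The second component of the decoded number is discarded, so that every pair of rationals occurs at
  arbitrarily late positions.\<close>

definition rat_pair :: "nat \<Rightarrow> real \<times> real" where
  "rat_pair n = map_prod of_rat of_rat (from_nat (fst (prod_decode n)) :: rat \<times> rat)"

text \<open>Step \<open>n\<close> takes care of the pair \<open>rat_pair n\<close>. If nothing survives from \<open>p\<close> to \<open>q\<close>, it may split
  off the empty interval.\<close>

definition advances :: "nat \<Rightarrow> (real \<Rightarrow> 'v set) \<Rightarrow> (real \<Rightarrow> 'v) \<Rightarrow> (real \<Rightarrow> 'v set) \<Rightarrow> bool" where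
  "advances n S y S' \<longleftrightarrow> radical_subfunctor S' \<and> splits_off S y S' \<and>
    (case rat_pair n of (p, q) \<Rightarrow> p < q \<longrightarrow> T p q ` S p \<noteq> {\<zero>\<^bsub>V q\<^esub>} \<longrightarrow> T p q ` S' p \<subset> T p q ` S p)"

lemma advances_exists:
  assumes S: "radical_subfunctor S"
  shows "\<exists>y S'. advances n S y S'"
proof -
  obtain p q where pq: "rat_pair n = (p, q)" by force
  show ?thesis
  proof (cases "p < q \<and> T p q ` S p \<noteq> {\<zero>\<^bsub>V q\<^esub>}")
    case True
    have "T p q \<zero>\<^bsub>V p\<^esub> = \<zero>\<^bsub>V q\<^esub>" "\<zero>\<^bsub>V p\<^esub> \<in> S p"
      using T_zero[of p q] True subfunctor_zero[OF radical_subfunctorD(1)[OF S]] by auto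
    then have "\<zero>\<^bsub>V q\<^esub> \<in> T p q ` S p" by (metis imageI)
    then obtain w where "w \<in> T p q ` S p" "w \<noteq> \<zero>\<^bsub>V q\<^esub>"
      using True subset_singletonD[of "T p q ` S p"] by (cases "T p q ` S p \<subseteq> {\<zero>\<^bsub>V q\<^esub>}") auto
    then obtain z where z: "z \<in> S p" "T p q z \<noteq> \<zero>\<^bsub>V q\<^esub>" by blast
    obtain y S' where "radical_subfunctor S'" "splits_off S y S'" "T p q ` S' p \<subset> T p q ` S p"
      using interval_summand_exists[OF S _ z] True by metis
    then have "advances n S y S'" by (simp add: advances_def pq)
    then show ?thesis by blast
  next
    case False
    have "splits_off S (\<lambda>t. \<zero>\<^bsub>V t\<^esub>) S"
      using subset_adjoin[OF vectorspace_V subfunctor_sub[OF radical_subfunctorD(1)[OF S]]]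
        subfunctor_zero[OF radical_subfunctorD(1)[OF S]] by (auto simp: splits_off_def)
    then have "advances n S (\<lambda>t. \<zero>\<^bsub>V t\<^esub>) S" using S False by (auto simp: advances_def pq)
    then show ?thesis by blast
  qed
qed

text \<open>For rationals \<open>a < b\<close> the images of \<open>S n a\<close> at time \<open>b\<close> form a decreasing sequence of subspaces of
  a finite-dimensional space. They become constant, and the constant value is zero as the pair is
  treated again and again. Two rationals inserted before \<open>t\<close> then give the exhaustion.\<close>

lemma splitting_sequence_exists:
  obtains S y where "splitting_sequence M S y" "S 0 = rad_space"
proof -
  define F where "F n S = (SOME b. advances n S (fst b) (snd b))" for n S
  have F: "advances n S (fst (F n S)) (snd (F n S))" if "radical_subfunctor S" for n S
    unfolding F_def using advances_exists[OF that, of n]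
    by (intro someI_ex[of "\<lambda>b. advances n S (fst b) (snd b)"]) simp
  define S where "S = rec_nat rad_space (\<lambda>n S. snd (F n S))"
  define y where "y n = fst (F n (S n))" for n
  have S_simps: "S 0 = rad_space" "S (Suc n) = snd (F n (S n))" for n by (simp_all add: S_def)
  have S: "radical_subfunctor (S n)" for n
  proof (induction n)
    case 0
    show ?case unfolding S_simps by (rule radical_subfunctor_rad_space)
  next
    case (Suc n)
    then show ?case using F[of "S n" n] unfolding S_simps advances_def by blast
  qed
  have adv: "advances n (S n) (y n) (S (Suc n))" for n
    unfolding y_def S_simps(2) by (rule F[OF S])
  have split: "splits_off (S n) (y n) (S (Suc n))" for n using adv by (simp add: advances_def)
  have S_anti: "S n t \<subseteq> S m t" if "m \<le> n" for m n t
    using lift_Suc_antimono_le[of "\<lambda>n. S n t", OF _ that] split unfolding splits_off_def by blast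
  note sf = radical_subfunctorD(1)[OF S]
  have vanish: "\<exists>N. T (of_rat a) (of_rat b) ` S N (of_rat a) = {\<zero>\<^bsub>V (of_rat b)\<^esub>}"
    if "a < b" for a b :: rat
  proof -
    let ?p = "of_rat a :: real" and ?q = "of_rat b :: real"
    have pq: "?p < ?q" using that by (simp add: of_rat_less)
    have "\<exists>W\<in>range (\<lambda>n. T ?p ?q ` S n ?p). \<forall>U\<in>range (\<lambda>n. T ?p ?q ` S n ?p). U \<subseteq> W \<longrightarrow> U = W"
    proof (rule minimal_subspace_of_image[OF pq])
      fix W assume "W \<in> range (\<lambda>n. T ?p ?q ` S n ?p)"
      then obtain n where n: "W = T ?p ?q ` S n ?p" by (elim rangeE)
      show "submodule class_ring W (V ?q)" "W \<subseteq> pm_im M ?p ?q"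
        unfolding n using submodule_image[OF sf] image_subset_pm_im[OF sf] pq by simp_all
    qed simp
    then obtain N where N: "T ?p ?q ` S n ?p \<subseteq> T ?p ?q ` S N ?p \<Longrightarrow>
        T ?p ?q ` S n ?p = T ?p ?q ` S N ?p" for n
      by (auto simp only: bex_simps ball_simps)
    \<comment> \<open>The images of the \<open>S n\<close> decrease and are constant from \<open>N\<close> on. A later step for the same pair
      would make a nonzero image smaller.\<close>
    define n where "n = prod_encode (to_nat (a, b), N)"
    have "N \<le> n" unfolding n_def by (rule le_prod_encode_2)
    have "T ?p ?q ` S n ?p = T ?p ?q ` S N ?p"
      using N[OF image_mono[OF S_anti[OF \<open>N \<le> n\<close>]]] .
    moreover have "T ?p ?q ` S (Suc n) ?p = T ?p ?q ` S N ?p"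
      using N[OF image_mono[OF S_anti[of N "Suc n"]]] \<open>N \<le> n\<close> by simp
    moreover have "rat_pair n = (?p, ?q)" by (simp add: rat_pair_def n_def)
    ultimately have "T ?p ?q ` S n ?p = {\<zero>\<^bsub>V ?q\<^esub>}"
      using adv[of n] pq by (auto simp: advances_def)
    then show ?thesis by blast
  qed
  have "splitting_sequence M S y"
  proof (unfold_locales, goal_cases)
    case (1 n)
    show ?case by (rule sf)
  next
    case (2 n)
    show ?case by (rule split)
  next
    case (3 v t)
    then obtain s z where s: "s < t" "z \<in> S 0 s" "v = T s t z"
      using radical_subfunctorD(2)[OF S] by blast
    obtain b where b: "s < of_rat b" "of_rat b < t" using of_rat_dense[OF s(1)] by blast
    obtain a where a: "s < of_rat a" "of_rat a < (of_rat b :: real)" using of_rat_dense[OF b(1)] by blast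
    obtain N where N: "T (of_rat a) (of_rat b) ` S N (of_rat a) = {\<zero>\<^bsub>V (of_rat b)\<^esub>}"
      using vanish[of a b] a by (auto simp: of_rat_less)
    have "T s t u = \<zero>\<^bsub>V t\<^esub>" if u: "u \<in> S N s" for u
    proof -
      have "T s t u = T (of_rat b) t (T (of_rat a) (of_rat b) (T s (of_rat a) u))"
        using a b subfunctor_carrier[OF sf u] by (simp add: map_comp T_closed)
      also have "T (of_rat a) (of_rat b) (T s (of_rat a) u) = \<zero>\<^bsub>V (of_rat b)\<^esub>"
        using N subfunctor_T[OF sf _ u, of "of_rat a"] a by auto
      finally show ?thesis using T_zero b by simp
    qed
    then show ?case using s by (intro exI[of _ s] conjI bexI[of _ z] exI[of _ N]) auto
  qed
  then show thesis using S_simps by (intro that[of S y]) auto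
qed

end

theorem theorem1p2:
  fixes M :: "('k :: field, 'v) pers_mod"
  assumes "persistence_module M"
    and "q_tame M"
  shows "\<exists>(I :: nat set) (J :: nat \<Rightarrow> real set).
    (\<forall>i\<in>I. is_interval (J i) \<and> J i \<noteq> {}) \<and>
    pm_isomorphic (rad M) (pm_direct_sum I (\<lambda>i. interval_module (J i)))"
proof -
  interpret q_tame_module M using assms by (simp add: q_tame_module_def q_tame_module_axioms_def)
  obtain Q z where Q: "splitting_sequence M Q z" "Q 0 = rad_space" by (rule splitting_sequence_exists)
  interpret splitting_sequence M Q z by (rule Q(1))
  have "pm_isomorphic (rad M) interval_sum"
    by (rule decomposition) (simp_all add: rad_carrier Q(2), simp add: rad_def)
  moreover have "\<forall>i\<in>index. is_interval (J i) \<and> J i \<noteq> {}" using is_interval_J by (simp add: index_def)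
  ultimately show ?thesis by blast
qed

end
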